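(* Let $n\ge 1$ and $h\ge 2$ be integers. The Graovac-Pisanski index $\widehat{W}(ZT(n,h))$ of the zig-zag tubulene $ZT(n,h)$ is given by the following closed formulas. (1) $h$ odd, $n$ odd: - if $n<h-2$: $\widehat{W}(ZT(n,h))=\frac{h}{6}(n+1)^2(6h^2+3hn+3h+n^2+2n-3)$; - if $n=h-2$, $n\ge3$: $\widehat{W}(ZT(n,h))=\frac{h}{6}(n+1)(6h^2n+3h^2+3hn^2+12hn+9h+n^3-7n-3)$; - if $n\ge h$, $h\ge5$: $\widehat{W}(ZT(n,h))=\frac{h}{6}(n+1)(h^3+3h^2n+3h^2+6hn^2+12hn+5h-3n-3)$. (2) $h$ even, $n$ odd: - if $n<h-2$: $\widehat{W}(ZT(n,h))=\frac{h}{6}(n+1)^2(6h^2+3hn+3h+n^2+2n+3)$; - if $n=h-1$, $n\ge3$: $\widehat{W}(ZT(n,h))=\frac{h}{6}(n+1)(6h^2n+3h^2+3hn^2+12hn+9h+n^3-n)$; - if $n\ge h$, $h\ge4$: $\widehat{W}(ZT(n,h))=\frac{h^2}{6}(n+1)(h^2+3hn+3h+6n^2+12n+8)$. (3) $h$ odd, $n$ even: - if $n<h-2$: $\widehat{W}(ZT(n,h))=\frac{h}{6}(n+1)(6h^2n+6h^2+3hn^2+6hn+n^3+3n^2+2n)$; - if $n=h-1$, $n\ge4$: $\widehat{W}(ZT(n,h))=\frac{h}{6}(n+1)(6h^2n+3h^2+3hn^2+12hn+6h+n^3-4n-3)$; - if $n\ge h$, $h\ge5$: $\widehat{W}(ZT(n,h))=\frac{h}{6}(n+1)(h^3+3h^2n+3h^2+6hn^2+12hn+5h-3n-3)$.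 (4) $h$ even, $n$ even: - if $n<h-2$: $\widehat{W}(ZT(n,h))=\frac{h}{6}(n+1)(6h^2n+6h^2+3hn^2+6hn+n^3+3n^2+2n)$; - if $n=h-2$, $n\ge4$: $\widehat{W}(ZT(n,h))=\frac{h}{6}(n+1)(6h^2n+3h^2+3hn^2+12hn+6h+n^3-4n)$; - if $n\ge h$, $h\ge6$: $\widehat{W}(ZT(n,h))=\frac{h^2}{6}(n+1)(h^2+3hn+3h+6n^2+12n+2)$.
   Context: For a finite connected graph $G$ with distance function $d_G$ (length of a shortest path) and automorphism group $\mathrm{Aut}(G)$, the Graovac-Pisanski index is $$\widehat{W}(G) = \frac{|V(G)|}{2\,|\mathrm{Aut}(G)|} \sum_{u \in V(G)} \sum_{\alpha \in \mathrm{Aut}(G)} d_G(u,\alpha(u)).$$ For integers $n\ge1$, $h\ge2$, the zig-zag tubulene $ZT(n,h)$ is the graph formed by rolling up a strip of the hexagonal lattice into a cylinder with $n$ layers of hexagons, each containing exactly $h$ hexagons, bounded by two cycles of the shortest possible length $2h$ encircling the cylinder. Explicitly, up to labelling, its vertices are $v^k_{i,j}$ with type $k\in\{0,1\}$, layer $i\in\{0,\ldots,n\}$ and $j\in\{0,\ldots,h-1\}$ (indices $j$ taken modulo $h$), and its edges are: $v^0_{i,j}v^1_{i,j}$ and $v^1_{i,j}v^0_{i,j+1}$ for all $i\in\{0,\ldots,n\}$ and all $j$ (so each layer induces a cycle of length $2h$), and $v^1_{i,j}v^0_{i+1,j}$ for all $i\in\{0,\ldots,n-1\}$ and all $j$.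 *)

theory Defs
  imports Complex_Main "HOL-Combinatorics.Permutations"
begin

text \<open>Simple undirected graphs; the edges are two-element sets of vertices.\<close>

record 'a ugraph =
  verts :: "'a set"
  edges :: "'a set set"

definition is_path :: "'a ugraph \<Rightarrow> 'a \<Rightarrow> 'a list \<Rightarrow> 'a \<Rightarrow> bool" where
  "is_path G u p v \<longleftrightarrow>
     p \<noteq> [] \<and> hd p = u \<and> last p = v \<and> distinct p \<and> set p \<subseteq> verts G \<and>
     (\<forall>i. Suc i < length p \<longrightarrow> {p ! i, p ! Suc i} \<in> edges G)"

text \<open>Paths are given by their vertex lists, so the length of a path (its number of edges) is one
  less than the length of the list. The value is meaningful only if \<open>u\<close> and \<open>v\<close> are connected.\<close>

definition graph_dist :: "'a ugraph \<Rightarrow> 'a \<Rightarrow> 'a \<Rightarrow> nat" where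
  "graph_dist G u v = (LEAST k. \<exists>p. is_path G u p v \<and> k = length p - 1)"

text \<open>By \<open>permutes\<close>, automorphisms are the identity outside of the vertex set, so that distinct
  elements of \<open>Aut G\<close> differ on vertices and the cardinality of \<open>Aut G\<close> is the group order.\<close>

definition Aut :: "'a ugraph \<Rightarrow> ('a \<Rightarrow> 'a) set" where
  "Aut G = {\<alpha>. \<alpha> permutes verts G \<and>
     (\<forall>u\<in>verts G. \<forall>v\<in>verts G. {\<alpha> u, \<alpha> v} \<in> edges G \<longleftrightarrow> {u, v} \<in> edges G)}"

definition GP_index :: "'a ugraph \<Rightarrow> real" where
  "GP_index G = real (card (verts G)) / (2 * real (card (Aut G))) *
     (\<Sum>u\<in>verts G. \<Sum>\<alpha>\<in>Aut G. real (graph_dist G u (\<alpha> u)))"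

text \<open>The zig-zag tubulene; the vertex \<open>v\<close> of type \<open>k\<close> in layer \<open>i\<close> at position \<open>j\<close> is the triple
  \<open>(k, i, j)\<close>.\<close>

definition ZT :: "nat \<Rightarrow> nat \<Rightarrow> (nat \<times> nat \<times> nat) ugraph" where
  "ZT n h = \<lparr>
     verts = {0, 1} \<times> {0..n} \<times> {0..<h},
     edges = {{(0, i, j), (1, i, j)} | i j. i \<le> n \<and> j < h}
           \<union> {{(1, i, j), (0, i, (j + 1) mod h)} | i j. i \<le> n \<and> j < h}
           \<union> {{(1, i, j), (0, i + 1, j)} | i j. i < n \<and> j < h} \<rparr>"

end

theory Submission
  imports Defs
begin

text \<open>In brick wall coordinates the distance between two vertices is the number of vertical steps plus the
  larger of the cyclic horizontal distance and the number of horizontal steps that the vertical ones force.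
  For \<open>h \<ge> 3\<close> the automorphism group consists of \<open>4 h\<close> maps: the rotations, combined with a reflection
  and with turning the tube upside down. Hence the images of a vertex \<open>(k, i, j)\<close> run twice through the
  vertices of type \<open>k\<close> in layer \<open>i\<close> and twice through those of type \<open>1 - k\<close> in layer \<open>n - i\<close>. The sum of
  the distances to one such half layer is a sum of \<open>max (cyc z) \<bar>y\<bar>\<close> over the residues \<open>z\<close> modulo \<open>2 h\<close> with
  the parity of \<open>y\<close>; it equals \<open>(h\<^sup>2 + y\<^sup>2) / 2\<close>, up to a parity correction, for \<open>\<bar>y\<bar> \<le> h\<close> and \<open>h \<bar>y\<bar>\<close> for
  larger \<open>\<bar>y\<bar>\<close>, which is the source of the case distinction between \<open>n < h\<close> and \<open>n \<ge> h\<close>.\<close>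

section \<open>Distances\<close>

text \<open>A potential argument: the Lipschitz condition makes \<open>f v\<close> a lower bound for
  the length of every path from \<open>u\<close>, and following descents backwards from
  \<open>v\<close> yields a path that attains it.\<close>

lemma graph_dist_eqI:
  fixes f :: "'a \<Rightarrow> nat"
  assumes u: "u \<in> verts G" "f u = 0"
    and lipschitz: "\<And>x y. x \<in> verts G \<Longrightarrow> y \<in> verts G \<Longrightarrow> {x, y} \<in> edges G \<Longrightarrow> f y \<le> Suc (f x)"
    and descent: "\<And>x. x \<in> verts G \<Longrightarrow> x \<noteq> u \<Longrightarrow> \<exists>y\<in>verts G. {y, x} \<in> edges G \<and> f x = Suc (f y)"
    and v: "v \<in> verts G"
  shows "graph_dist G u v = f v"
proof -
  have ex: "\<exists>p. is_path G u p v \<and> length p = Suc m \<and> (\<forall>i<length p. f (p ! i) = i)"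
    if "v \<in> verts G" "f v = m" for m v
    using that
  proof (induction m arbitrary: v)
    case 0
    then have "v = u" using descent by fastforce
    then show ?case using u by (intro exI[of _ "[u]"]) (simp add: is_path_def)
  next
    case (Suc m)
    then have "v \<noteq> u" using u by auto
    then obtain y where y: "y \<in> verts G" "{y, v} \<in> edges G" "f v = Suc (f y)"
      using descent Suc.prems by blast
    then obtain p where p: "is_path G u p y" "length p = Suc m" "\<forall>i<length p. f (p ! i) = i"
      using Suc.IH[of y] Suc.prems by auto
    \<comment> \<open>Along \<open>p\<close> the values of \<open>f\<close> run from
      \<open>0\<close> to \<open>m\<close>, while \<open>f v = Suc m\<close>; this keeps the
      extended path free of repetitions.\<close>
    have "v \<notin> set p"
      using p(2,3) Suc.prems(2) by (auto simp: in_set_conv_nth)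
    moreover have "{(p @ [v]) ! i, (p @ [v]) ! Suc i} \<in> edges G" if "Suc i < length (p @ [v])" for i
    proof (cases "Suc i < length p")
      case True
      then show ?thesis using p(1) by (auto simp: is_path_def nth_append)
    next
      case False
      then have "i = m" using that p(2) by auto
      moreover have "p ! m = y" using p(1,2) by (auto simp: is_path_def last_conv_nth)
      ultimately show ?thesis using p(2) y(2) by (simp add: nth_append)
    qed
    ultimately have "is_path G u (p @ [v]) v"
      using p(1) Suc.prems(1) by (auto simp: is_path_def)
    then show ?case
      using p(2,3) Suc.prems(2) by (intro exI[of _ "p @ [v]"]) (auto simp: nth_append less_Suc_eq)
  qed
  have low: "f v \<le> length p - 1" if p: "is_path G u p v" for p
  proof -
    have "f (p ! i) \<le> i" if "i < length p" for i
      using that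
    proof (induction i)
      case 0
      then show ?case using p u by (simp add: is_path_def hd_conv_nth)
    next
      case (Suc i)
      have "f (p ! Suc i) \<le> Suc (f (p ! i))"
        using p Suc.prems by (intro lipschitz) (auto simp: is_path_def)
      then show ?case using Suc by force
    qed
    from this[of "length p - 1"] show ?thesis
      using p by (auto simp: is_path_def last_conv_nth)
  qed
  show ?thesis
    unfolding graph_dist_def
  proof (rule Least_equality)
    show "\<exists>p. is_path G u p v \<and> f v = length p - 1"
      using ex[OF v refl] by auto
  qed (use low in auto)
qed

section \<open>Adjacency in the tubulene\<close>

lemma ZT_verts_iff:
  "(k, i, j) \<in> verts (ZT n h) \<longleftrightarrow> (k = 0 \<or> k = 1) \<and> i \<le> n \<and> j < h"
  by (auto simp: ZT_def)

text \<open>Adjacency of \<open>(1, i, j)\<close> to \<open>(0, i', j')\<close>. Every edge joins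
  vertices of different types, so this oriented relation describes all edges.\<close>

definition zt_link :: "nat \<Rightarrow> nat \<Rightarrow> nat \<Rightarrow> nat \<Rightarrow> nat \<Rightarrow> bool" where
  "zt_link h i j i' j' \<longleftrightarrow> i' = i \<and> (j' = j \<or> j' = (j + 1) mod h) \<or> i' = i + 1 \<and> j' = j"

lemma ZT_edge_iff:
  assumes "(k, i, j) \<in> verts (ZT n h)" "(k', i', j') \<in> verts (ZT n h)"
  shows "{(k, i, j), (k', i', j')} \<in> edges (ZT n h) \<longleftrightarrow>
    k = 1 \<and> k' = 0 \<and> zt_link h i j i' j' \<or> k = 0 \<and> k' = 1 \<and> zt_link h i' j' i j"
proof -
  have e: "{(k, i, j), (k', i', j')} \<in> edges (ZT n h) \<longleftrightarrow>
     (\<exists>a b. {(k, i, j), (k', i', j')} = {(0, a, b), (1, a, b)} \<and> a \<le> n \<and> b < h) \<or>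
     (\<exists>a b. {(k, i, j), (k', i', j')} = {(1, a, b), (0, a, (b + 1) mod h)} \<and> a \<le> n \<and> b < h) \<or>
     (\<exists>a b. {(k, i, j), (k', i', j')} = {(1, a, b), (0, a + 1, b)} \<and> a < n \<and> b < h)"
    by (simp only: ZT_def ugraph.simps Un_iff mem_Collect_eq disj_assoc)
  have "k = 0 \<or> k = 1" "k' = 0 \<or> k' = 1" and ij: "i \<le> n" "j < h" "i' \<le> n" "j' < h"
    using assms by (auto simp: ZT_verts_iff)
  then consider "k = k'" | "k = 1" "k' = 0" | "k = 0" "k' = 1" by auto
  then show ?thesis
  proof cases
    case 1
    then show ?thesis unfolding e doubleton_eq_iff by auto
  next
    case 2
    have "(\<exists>a b. {(k, i, j), (k', i', j')} = {(0, a, b), (1, a, b)} \<and> a \<le> n \<and> b < h)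
        \<longleftrightarrow> i' = i \<and> j' = j"
      using 2 ij by (auto simp: doubleton_eq_iff)
    moreover have "(\<exists>a b. {(k, i, j), (k', i', j')} = {(1, a, b), (0, a, (b + 1) mod h)} \<and> a \<le> n \<and> b < h)
        \<longleftrightarrow> i' = i \<and> j' = (j + 1) mod h"
      using 2 ij by (auto simp: doubleton_eq_iff)
    moreover have "(\<exists>a b. {(k, i, j), (k', i', j')} = {(1, a, b), (0, a + 1, b)} \<and> a < n \<and> b < h)
        \<longleftrightarrow> i' = i + 1 \<and> j' = j"
      using 2 ij by (auto simp: doubleton_eq_iff)
    ultimately show ?thesis unfolding e zt_link_def using 2 by auto
  next
    case 3
    have "(\<exists>a b. {(k, i, j), (k', i', j')} = {(0, a, b), (1, a, b)} \<and> a \<le> n \<and> b < h)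
        \<longleftrightarrow> i' = i \<and> j' = j"
      using 3 ij by (auto simp: doubleton_eq_iff)
    moreover have "(\<exists>a b. {(k, i, j), (k', i', j')} = {(1, a, b), (0, a, (b + 1) mod h)} \<and> a \<le> n \<and> b < h)
        \<longleftrightarrow> i' = i \<and> j = (j' + 1) mod h"
      using 3 ij by (auto simp: doubleton_eq_iff)
    moreover have "(\<exists>a b. {(k, i, j), (k', i', j')} = {(1, a, b), (0, a + 1, b)} \<and> a < n \<and> b < h)
        \<longleftrightarrow> i = i' + 1 \<and> j = j'"
      using 3 ij by (auto simp: doubleton_eq_iff)
    ultimately show ?thesis unfolding e zt_link_def using 3 by auto
  qed
qed

section \<open>Cyclic distance\<close>

text \<open>Distance from \<open>z\<close> to the nearest multiple of \<open>m\<close>, that is, the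
  distance between \<open>0\<close> and \<open>z\<close> on a cycle of length
  \<open>m\<close>.\<close>

definition cyc :: "int \<Rightarrow> int \<Rightarrow> int" where
  "cyc m z = min (z mod m) (m - z mod m)"

lemma mod_succ_int: "(z + 1) mod m = (if z mod m + 1 = m then 0 else z mod m + 1)"
  if "m > 0" for z m :: int
proof -
  have "(z + 1) mod m = (z mod m + 1) mod m" by (simp add: mod_simps)
  moreover have "0 \<le> z mod m" "z mod m < m" using that by auto
  ultimately show ?thesis by auto
qed

lemma mod_pred_int: "(z - 1) mod m = (if z mod m = 0 then m - 1 else z mod m - 1)"
  if "m > 0" for z m :: int
proof -
  have "z mod m = (if (z - 1) mod m + 1 = m then 0 else (z - 1) mod m + 1)"
    using mod_succ_int[OF that, of "z - 1"] by simp
  moreover have "0 \<le> (z - 1) mod m" "(z - 1) mod m < m" using that by auto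
  ultimately show ?thesis by auto
qed

lemma cyc_nonneg: "m > 0 \<Longrightarrow> cyc m z \<ge> 0"
  by (auto simp: cyc_def less_imp_le)

lemma cyc_le_half: "2 * cyc m z \<le> m"
  by (simp add: cyc_def min_def)

lemma cyc_add_period [simp]: "cyc m (z + m) = cyc m z" "cyc m (z - m) = cyc m z"
  by (auto simp: cyc_def)

lemma cyc_succ_le: "m > 0 \<Longrightarrow> \<bar>cyc m (z + 1) - cyc m z\<bar> \<le> 1"
  using pos_mod_bound[of m z] pos_mod_sign[of m z]
  by (simp add: cyc_def mod_succ_int min_def abs_if)

lemma cyc_pred_le: "m > 0 \<Longrightarrow> \<bar>cyc m (z - 1) - cyc m z\<bar> \<le> 1"
  using cyc_succ_le[of m "z - 1"] by (simp add: abs_minus_commute)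

lemma cyc_descent:
  assumes "m > 0" "cyc m z > 0"
  shows "cyc m (z + 1) = cyc m z - 1 \<or> cyc m (z - 1) = cyc m z - 1"
  using assms pos_mod_bound[of m z] pos_mod_sign[of m z]
  by (auto simp: cyc_def mod_succ_int mod_pred_int min_def split: if_splits)

lemma even_cyc_iff: "even m \<Longrightarrow> even (cyc m z) \<longleftrightarrow> even z"
  by (auto simp: cyc_def min_def dvd_mod_iff)

lemma cyc_eq_0_iff: "m > 0 \<Longrightarrow> cyc m z = 0 \<longleftrightarrow> m dvd z"
  using pos_mod_bound[of m z] by (simp add: cyc_def min_def dvd_eq_mod_eq_0 less_le)

text \<open>Give the vertex \<open>(k, i, j)\<close> the horizontal coordinate \<open>2 j + k + i\<close> modulo \<open>2 h\<close>, which vertical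
  edges preserve and horizontal edges change by one. Between two given vertices \<open>\<bar>i' - i\<bar>\<close> vertical
  steps are needed, two vertical steps in the same direction have a horizontal one in between, so that
  \<open>\<bar>y\<bar>\<close> horizontal steps are forced, and at least the cyclic distance of the horizontal coordinates
  has to be covered.\<close>

definition zt_dist :: "nat \<Rightarrow> nat \<times> nat \<times> nat \<Rightarrow> nat \<times> nat \<times> nat \<Rightarrow> int" where
  "zt_dist h = (\<lambda>(k, i, j) (k', i', j').
     let y = int i' - int i + int k' - int k
     in \<bar>int i' - int i\<bar> + max (cyc (2 * int h) (2 * (int j' - int j) + y)) \<bar>y\<bar>)"

section \<open>The distance formula\<close>

text \<open>The third case is the horizontal step across the seam; compared with the second, it
  shifts the horizontal coordinate by the full period \<open>2 * int h\<close>, which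
  \<open>cyc\<close> does not see.\<close>

lemma zt_link_cases:
  assumes "zt_link h i j i' j'" "j < h"
  obtains "i' = i" "j' = j" | "i' = i" "int j' = int j + 1" | "i' = i" "int j' = int j + 1 - int h"
    | "i' = i + 1" "j' = j"
  using assms by (auto simp: zt_link_def mod_if split: if_splits)

text \<open>A horizontal edge keeps the layer and changes both \<open>y\<close> and, up to the
  period, the argument of \<open>cyc\<close> by one. A vertical edge keeps these two and changes the
  layer difference by one.\<close>

lemma zt_dist_link:
  assumes "h > 0" "zt_link h i j i' j'" "j < h"
  shows "\<bar>zt_dist h u (0, i', j') - zt_dist h u (1, i, j)\<bar> \<le> 1"
proof -
  obtain k0 i0 j0 where u: "u = (k0, i0, j0)" by (cases u)
  define y where "y = int i - int i0 + 1 - int k0"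
  define z where "z = 2 * (int j - int j0) + y"
  define D where "D = int i - int i0"
  let ?c = "cyc (2 * int h)"
  have 1: "zt_dist h u (1, i, j) = \<bar>D\<bar> + max (?c z) \<bar>y\<bar>"
    by (simp add: u zt_dist_def y_def z_def D_def Let_def)
  have m: "2 * int h > 0" using assms by simp
  from assms(2,3) show ?thesis
  proof (cases rule: zt_link_cases)
    case 1
    then have "zt_dist h u (0, i', j') = \<bar>D\<bar> + max (?c (z - 1)) \<bar>y - 1\<bar>"
      by (simp add: u zt_dist_def y_def z_def D_def Let_def algebra_simps)
    then show ?thesis using \<open>zt_dist h u (1, i, j) = _\<close> cyc_pred_le[OF m, of z] by linarith
  next
    case 2
    then have "zt_dist h u (0, i', j') = \<bar>D\<bar> + max (?c (z + 1)) \<bar>y - 1\<bar>"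
      by (simp add: u zt_dist_def y_def z_def D_def Let_def algebra_simps)
    then show ?thesis using \<open>zt_dist h u (1, i, j) = _\<close> cyc_succ_le[OF m, of z] by linarith
  next
    case 3
    have "zt_dist h u (0, i', j') = \<bar>D\<bar> + max (?c (z + 1 - 2 * int h)) \<bar>y - 1\<bar>"
      by (simp add: 3 u zt_dist_def y_def z_def D_def Let_def algebra_simps)
    then show ?thesis using \<open>zt_dist h u (1, i, j) = _\<close> cyc_succ_le[OF m, of z]
      unfolding cyc_add_period by linarith
  next
    case 4
    then have "zt_dist h u (0, i', j') = \<bar>D + 1\<bar> + max (?c z) \<bar>y\<bar>"
      by (simp add: u zt_dist_def y_def z_def D_def Let_def algebra_simps)
    then show ?thesis using \<open>zt_dist h u (1, i, j) = _\<close> by linarith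
  qed
qed

text \<open>As \<open>cyc m z\<close> and \<open>y\<close> have the same parity, if one of them is 0 then the other is at least 2 in absolute
  value, so that the increase of the former to 1 does not matter.\<close>

lemma max_cyc_descent:
  assumes m: "m > 0" "even m" and parity: "even z \<longleftrightarrow> even y"
    and pos: "y \<noteq> 0 \<or> cyc m z > 0"
    and y': "\<bar>y'\<bar> = \<bar>y\<bar> - 1 \<or> y = 0 \<and> \<bar>y'\<bar> = 1"
  shows "max (cyc m (z + 1)) \<bar>y'\<bar> = max (cyc m z) \<bar>y\<bar> - 1 \<or>
         max (cyc m (z - 1)) \<bar>y'\<bar> = max (cyc m z) \<bar>y\<bar> - 1"
proof (cases "cyc m z > 0")
  case True
  have "cyc m z \<ge> 2" if "y = 0"
    using True even_cyc_iff[OF m(2), of z] parity that by (cases "cyc m z = 1") auto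
  then show ?thesis using cyc_descent[OF m(1) True] y' by (smt (verit))
next
  case False
  then have c: "cyc m z = 0" using cyc_nonneg[OF m(1), of z] by simp
  then have "even y" using even_cyc_iff[OF m(2), of z] parity by simp
  then have "\<bar>y\<bar> \<ge> 2" using pos c by (cases "y = 1"; cases "y = - 1") auto
  then show ?thesis using cyc_succ_le[OF m(1), of z] cyc_nonneg[OF m(1), of "z + 1"] y' c by (smt (verit))
qed

lemma zt_dist_nonneg: "h > 0 \<Longrightarrow> zt_dist h u v \<ge> 0"
  by (cases u; cases v) (auto simp: zt_dist_def Let_def)

text \<open>If a vertical edge leads from \<open>x\<close> towards the layer of \<open>u\<close>,
  that edge lowers the distance. Otherwise \<open>max_cyc_descent\<close> shows that one of the two
  horizontal edges does.\<close>

lemma zt_dist_descent: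
  assumes h: "h > 0" and u: "u \<in> verts (ZT n h)" and x: "x \<in> verts (ZT n h)" and ne: "x \<noteq> u"
  shows "\<exists>y\<in>verts (ZT n h). {y, x} \<in> edges (ZT n h) \<and> zt_dist h u x = zt_dist h u y + 1"
proof -
  obtain k0 i0 j0 where u_eq: "u = (k0, i0, j0)" by (cases u)
  obtain k i j where x_eq: "x = (k, i, j)" by (cases x)
  have ub: "k0 = 0 \<or> k0 = 1" "i0 \<le> n" "j0 < h" using u by (auto simp: u_eq ZT_verts_iff)
  have xb: "k = 0 \<or> k = 1" "i \<le> n" "j < h" using x by (auto simp: x_eq ZT_verts_iff)
  define D where "D = int i - int i0"
  define y where "y = D + int k - int k0"
  define z where "z = 2 * (int j - int j0) + y"
  let ?c = "cyc (2 * int h)"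
  have m: "2 * int h > 0" "even (2 * int h)" using h by auto
  have dx: "zt_dist h u x = \<bar>D\<bar> + max (?c z) \<bar>y\<bar>"
    by (simp add: u_eq x_eq zt_dist_def y_def z_def D_def Let_def)
  have parity: "even z \<longleftrightarrow> even y" by (simp add: z_def)
  \<comment> \<open>The sign condition excludes exactly the cases settled by a vertical edge. Under
    it \<open>y = 0\<close> forces equal types and layers, and a vanishing cyclic distance then
    forces \<open>j = j0\<close>, contrary to \<open>x \<noteq> u\<close>.\<close>
  have pos: "y \<noteq> 0 \<or> ?c z > 0" if "k = 1 \<and> D \<ge> 0 \<or> k = 0 \<and> D \<le> 0"
  proof (rule ccontr)
    assume "\<not> ?thesis"
    then have *: "y = 0" "?c z = 0" using cyc_nonneg[OF m(1), of z] by auto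
    then have ki: "k = k0" "i = i0" using that ub(1) by (auto simp: y_def D_def)
    have "2 * int h dvd 2 * (int j - int j0)"
      using * cyc_eq_0_iff[OF m(1), of z] unfolding z_def by simp
    then have "int h dvd int j - int j0" unfolding dvd_times_left_cancel_iff[OF zero_neq_numeral[symmetric]] .
    then have "j = j0" using ub(3) xb(3) zdvd_imp_le[of "int h" "int j - int j0"]
        zdvd_imp_le[of "int h" "int j0 - int j"] by (cases j j0 rule: linorder_cases) (auto simp: dvd_diff_commute)
    then show False using ki ne by (simp add: u_eq x_eq)
  qed
  have edgeI: ?thesis if "w \<in> verts (ZT n h)" "{w, x} \<in> edges (ZT n h)" "zt_dist h u w = zt_dist h u x - 1" for w
    using that by auto
  show ?thesis
  proof (cases "k = 1")
    case k: True
    show ?thesis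
    proof (cases "D < 0")
      case True
      show ?thesis
      proof (rule edgeI[of "(0, i + 1, j)"])
        show "(0, i + 1, j) \<in> verts (ZT n h)" using True ub xb by (auto simp: ZT_verts_iff D_def)
        then show "{(0, i + 1, j), x} \<in> edges (ZT n h)"
          using x k by (simp add: x_eq ZT_edge_iff zt_link_def)
        have "zt_dist h u (0, i + 1, j) = \<bar>D + 1\<bar> + max (?c z) \<bar>y\<bar>"
          using k by (simp add: u_eq zt_dist_def y_def z_def D_def Let_def algebra_simps)
        then show "zt_dist h u (0, i + 1, j) = zt_dist h u x - 1" using True dx by linarith
      qed
    next
      case False
      define j' where "j' = (j + 1) mod h"
      have j': "j' < h" "int j' = int j + 1 \<or> int j' = int j + 1 - int h"
        using xb(3) by (auto simp: j'_def mod_if)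
      have v: "(0, i, j) \<in> verts (ZT n h)" "(0, i, j') \<in> verts (ZT n h)"
        using xb j' by (auto simp: ZT_verts_iff)
      have e: "{(0, i, j), x} \<in> edges (ZT n h)" "{(0, i, j'), x} \<in> edges (ZT n h)"
        using v x k by (simp_all add: x_eq ZT_edge_iff zt_link_def j'_def)
      have "zt_dist h u (0, i, j) = \<bar>D\<bar> + max (?c (z - 1)) \<bar>y - 1\<bar>"
        using k by (simp add: u_eq zt_dist_def y_def z_def D_def Let_def algebra_simps)
      moreover have "zt_dist h u (0, i, j') = \<bar>D\<bar> + max (?c (2 * (int j' - int j0) + y - 1)) \<bar>y - 1\<bar>"
        using k by (simp add: u_eq zt_dist_def y_def D_def Let_def algebra_simps)
      moreover have "?c (2 * (int j' - int j0) + y - 1) = ?c (z + 1)"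
        using j'(2)
      proof
        assume *: "int j' = int j + 1"
        show ?thesis unfolding * z_def by (simp add: algebra_simps)
      next
        assume *: "int j' = int j + 1 - int h"
        have "2 * (int j' - int j0) + y - 1 = z + 1 - 2 * int h"
          unfolding * by (simp add: z_def)
        then show ?thesis by (simp only: cyc_add_period)
      qed
      \<comment> \<open>Here \<open>k = 1\<close> and \<open>D \<ge> 0\<close> give
        \<open>y \<ge> 0\<close>, so a horizontal step lowers \<open>\<bar>y\<bar>\<close> unless
        \<open>y = 0\<close>.\<close>
      moreover have "\<bar>y - 1\<bar> = \<bar>y\<bar> - 1 \<or> y = 0 \<and> \<bar>y - 1\<bar> = 1"
        using False k ub(1) by (auto simp: y_def)
      ultimately show ?thesis
        using max_cyc_descent[OF m parity pos, of "y - 1"] False k edgeI[OF v(1) e(1)] edgeI[OF v(2) e(2)] dx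
        by auto
    qed
  next
    case False
    then have k: "k = 0" using xb by simp
    show ?thesis
    proof (cases "D > 0")
      case True
      then have i: "i > 0" by (simp add: D_def)
      show ?thesis
      proof (rule edgeI[of "(1, i - 1, j)"])
        show "(1, i - 1, j) \<in> verts (ZT n h)" using xb by (auto simp: ZT_verts_iff)
        then show "{(1, i - 1, j), x} \<in> edges (ZT n h)"
          using x k i by (simp add: x_eq ZT_edge_iff zt_link_def)
        have "zt_dist h u (1, i - 1, j) = \<bar>D - 1\<bar> + max (?c z) \<bar>y\<bar>"
          using k i by (simp add: u_eq zt_dist_def y_def z_def D_def Let_def algebra_simps of_nat_diff)
        then show "zt_dist h u (1, i - 1, j) = zt_dist h u x - 1" using True dx by linarith
      qed
    next
      case False
      define j' where "j' = (if j = 0 then h - 1 else j - 1)"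
      have j': "j' < h" "int j' = int j - 1 \<or> int j' = int j - 1 + int h" "j = (j' + 1) mod h"
        using xb(3) h by (auto simp: j'_def)
      have v: "(1, i, j) \<in> verts (ZT n h)" "(1, i, j') \<in> verts (ZT n h)"
        using xb j' by (auto simp: ZT_verts_iff)
      have e: "{(1, i, j), x} \<in> edges (ZT n h)" "{(1, i, j'), x} \<in> edges (ZT n h)"
        using v x k j'(3) by (simp_all add: x_eq ZT_edge_iff zt_link_def)
      have "zt_dist h u (1, i, j) = \<bar>D\<bar> + max (?c (z + 1)) \<bar>y + 1\<bar>"
        using k by (simp add: u_eq zt_dist_def y_def z_def D_def Let_def algebra_simps)
      moreover have "zt_dist h u (1, i, j') = \<bar>D\<bar> + max (?c (2 * (int j' - int j0) + y + 1)) \<bar>y + 1\<bar>"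
        using k by (simp add: u_eq zt_dist_def y_def D_def Let_def algebra_simps)
      moreover have "?c (2 * (int j' - int j0) + y + 1) = ?c (z - 1)"
        using j'(2)
      proof
        assume *: "int j' = int j - 1"
        show ?thesis unfolding * z_def by (simp add: algebra_simps)
      next
        assume *: "int j' = int j - 1 + int h"
        have "2 * (int j' - int j0) + y + 1 = z - 1 + 2 * int h"
          unfolding * by (simp add: z_def)
        then show ?thesis by (simp only: cyc_add_period)
      qed
      moreover have "\<bar>y + 1\<bar> = \<bar>y\<bar> - 1 \<or> y = 0 \<and> \<bar>y + 1\<bar> = 1"
        using False k ub(1) by (auto simp: y_def)
      ultimately show ?thesis
        using max_cyc_descent[OF m parity pos, of "y + 1"] False k edgeI[OF v(1) e(1)] edgeI[OF v(2) e(2)] dx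
        by auto
    qed
  qed
qed

lemma ZT_graph_dist:
  assumes h: "h > 0" and u: "u \<in> verts (ZT n h)" and v: "v \<in> verts (ZT n h)"
  shows "graph_dist (ZT n h) u v = nat (zt_dist h u v)"
proof (rule graph_dist_eqI[OF u _ _ _ v])
  show "nat (zt_dist h u u) = 0"
    by (cases u) (simp add: zt_dist_def cyc_def)
next
  fix x y assume x: "x \<in> verts (ZT n h)" and y: "y \<in> verts (ZT n h)" and e: "{x, y} \<in> edges (ZT n h)"
  obtain k i j k' i' j' where eq: "x = (k, i, j)" "y = (k', i', j')" by (cases x; cases y)
  have b: "j < h" "j' < h" using x y by (auto simp: eq ZT_verts_iff)
  have "\<bar>zt_dist h u y - zt_dist h u x\<bar> \<le> 1"
    using e zt_dist_link[OF h _ b(1), of i i' j' u] zt_dist_link[OF h _ b(2), of i' i j u]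
    unfolding eq ZT_edge_iff[OF x[unfolded eq] y[unfolded eq]] by (auto simp: abs_minus_commute)
  then show "nat (zt_dist h u y) \<le> Suc (nat (zt_dist h u x))" by linarith
next
  fix x assume "x \<in> verts (ZT n h)" "x \<noteq> u"
  then obtain y where "y \<in> verts (ZT n h)" "{y, x} \<in> edges (ZT n h)" "zt_dist h u x = zt_dist h u y + 1"
    using zt_dist_descent[OF h u] by blast
  then show "\<exists>y\<in>verts (ZT n h). {y, x} \<in> edges (ZT n h) \<and> nat (zt_dist h u x) = Suc (nat (zt_dist h u y))"
    using zt_dist_nonneg[OF h, of u y] by (intro bexI[of _ y]) auto
qed

section \<open>Automorphisms\<close>

definition neighbours :: "'a ugraph \<Rightarrow> 'a \<Rightarrow> 'a set" where
  "neighbours G v = {w \<in> verts G. {v, w} \<in> edges G}"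

lemma Aut_permutes: "\<alpha> \<in> Aut G \<Longrightarrow> \<alpha> permutes verts G"
  by (simp add: Aut_def)

lemma Aut_edge_iff:
  "\<alpha> \<in> Aut G \<Longrightarrow> u \<in> verts G \<Longrightarrow> v \<in> verts G \<Longrightarrow> {\<alpha> u, \<alpha> v} \<in> edges G \<longleftrightarrow> {u, v} \<in> edges G"
  by (simp add: Aut_def)

lemma Aut_verts: "\<alpha> \<in> Aut G \<Longrightarrow> \<alpha> v \<in> verts G \<longleftrightarrow> v \<in> verts G"
  by (simp add: Aut_permutes permutes_in_image)

lemma Aut_eq_iff: "\<alpha> \<in> Aut G \<Longrightarrow> \<alpha> u = \<alpha> v \<longleftrightarrow> u = v"
  using Aut_permutes permutes_inj injD by metis

lemma Aut_comp: "\<alpha> \<in> Aut G \<Longrightarrow> \<beta> \<in> Aut G \<Longrightarrow> \<alpha> \<circ> \<beta> \<in> Aut G"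
  by (simp add: Aut_def permutes_compose permutes_in_image)

lemma Aut_inv:
  assumes "\<alpha> \<in> Aut G"
  shows "inv \<alpha> \<in> Aut G"
proof -
  have p: "inv \<alpha> permutes verts G" using Aut_permutes[OF assms] permutes_inv by blast
  have "{inv \<alpha> u, inv \<alpha> v} \<in> edges G \<longleftrightarrow> {u, v} \<in> edges G"
    if "u \<in> verts G" "v \<in> verts G" for u v
    using Aut_edge_iff[OF assms, of "inv \<alpha> u" "inv \<alpha> v"] that p
    by (simp add: permutes_in_image permutes_inverses[OF Aut_permutes[OF assms]])
  with p show ?thesis by (simp add: Aut_def)
qed

lemma Aut_neighbours:
  assumes "\<alpha> \<in> Aut G" "v \<in> verts G"
  shows "neighbours G (\<alpha> v) = \<alpha> ` neighbours G v"
proof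
  show "\<alpha> ` neighbours G v \<subseteq> neighbours G (\<alpha> v)"
    using assms by (auto simp: neighbours_def Aut_verts Aut_edge_iff)
  show "neighbours G (\<alpha> v) \<subseteq> \<alpha> ` neighbours G v"
  proof
    fix w assume w: "w \<in> neighbours G (\<alpha> v)"
    then have "w \<in> \<alpha> ` verts G"
      using permutes_image[OF Aut_permutes[OF assms(1)]] by (simp add: neighbours_def)
    then obtain x where "x \<in> verts G" "w = \<alpha> x" by auto
    then show "w \<in> \<alpha> ` neighbours G v"
      using w assms by (auto simp: neighbours_def Aut_edge_iff)
  qed
qed

lemma Aut_card_neighbours:
  assumes "\<alpha> \<in> Aut G" "v \<in> verts G"
  shows "card (neighbours G (\<alpha> v)) = card (neighbours G v)"
  unfolding Aut_neighbours[OF assms]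
  using Aut_eq_iff[OF assms(1)] by (intro card_image) (auto intro: inj_onI)

section \<open>Neighbourhoods and rigidity in the tubulene\<close>

lemma finite_ZT_verts: "finite (verts (ZT n h))"
  by (simp add: ZT_def)

lemma ZT_neighbours_0:
  assumes "(0, i, j) \<in> verts (ZT n h)"
  shows "neighbours (ZT n h) (0, i, j) =
    {(1, i, j), (1, i, if j = 0 then h - 1 else j - 1)} \<union> (if i = 0 then {} else {(1, i - 1, j)})"
proof -
  have "(k', i', j') \<in> neighbours (ZT n h) (0, i, j) \<longleftrightarrow> k' = 1 \<and>
     (i' = i \<and> (j' = j \<or> j' = (if j = 0 then h - 1 else j - 1)) \<or> i \<noteq> 0 \<and> i' = i - 1 \<and> j' = j)" for k' i' j'
  proof (cases "(k', i', j') \<in> verts (ZT n h)")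
    case True
    then have "j = (j' + 1) mod h \<longleftrightarrow> j' = (if j = 0 then h - 1 else j - 1)"
      using assms by (auto simp: ZT_verts_iff mod_if)
    then show ?thesis
      using True assms by (auto simp: neighbours_def ZT_edge_iff zt_link_def)
  next
    case False
    then show ?thesis using assms by (auto simp: neighbours_def ZT_verts_iff split: if_splits)
  qed
  then show ?thesis by auto
qed

lemma ZT_neighbours_1:
  assumes "(1, i, j) \<in> verts (ZT n h)"
  shows "neighbours (ZT n h) (1, i, j) =
    {(0, i, j), (0, i, (j + 1) mod h)} \<union> (if i = n then {} else {(0, i + 1, j)})"
proof -
  have "(k', i', j') \<in> neighbours (ZT n h) (1, i, j) \<longleftrightarrow> k' = 0 \<and>
     (i' = i \<and> (j' = j \<or> j' = (j + 1) mod h) \<or> i \<noteq> n \<and> i' = i + 1 \<and> j' = j)" for k' i' j'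
    using assms by (cases "(k', i', j') \<in> verts (ZT n h)")
      (auto simp: neighbours_def ZT_verts_iff ZT_edge_iff zt_link_def)
  then show ?thesis by auto
qed

lemmas ZT_neighbours = ZT_neighbours_0 ZT_neighbours_1[unfolded One_nat_def]

text \<open>With \<open>h \<ge> 2\<close> the two neighbours within the layer are distinct. Degree 2
  marks the type 0 vertices of layer \<open>0\<close> and the type 1 vertices of layer
  \<open>n\<close>, which locates the images of boundary vertices.\<close>

lemma ZT_degree:
  assumes "h \<ge> 2" "(k, i, j) \<in> verts (ZT n h)"
  shows "card (neighbours (ZT n h) (k, i, j)) = (if k = 0 \<and> i = 0 \<or> k = 1 \<and> i = n then 2 else 3)"
proof -
  have "k = 0 \<or> k = 1" "j < h" using assms by (auto simp: ZT_verts_iff)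
  moreover have "(j + 1) mod h \<noteq> j" using assms(1) \<open>j < h\<close> by (simp add: mod_if)
  ultimately show ?thesis
    using assms by (auto simp: ZT_neighbours card_insert_if)
qed

text \<open>On layer 0, degrees tell the next vertex of the layer from the vertex in layer 1. A vertex of type 1
  in a higher layer is the only common neighbour of two vertices of type 0, which needs \<open>h \<ge> 3\<close>.\<close>

lemma ZT_automorphism_rigid:
  assumes n: "n \<ge> 1" and h: "h \<ge> 3" and \<gamma>: "\<gamma> \<in> Aut (ZT n h)"
    and fixed: "\<gamma> (0, 0, 0) = (0, 0, 0)" "\<gamma> (1, 0, 0) = (1, 0, 0)"
  shows "\<gamma> = id"
proof -
  let ?N = "neighbours (ZT n h)"
  have nb: "\<gamma> w \<in> ?N v" if "w \<in> ?N v" "\<gamma> v = v" "v \<in> verts (ZT n h)" for v w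
    using Aut_neighbours[OF \<gamma> that(3)] that by auto
  have layer0: "\<gamma> (0, 0, j) = (0, 0, j) \<and> \<gamma> (1, 0, j) = (1, 0, j)" if "j < h" for j
    using that
  proof (induction j)
    case 0
    show ?case using fixed by simp
  next
    case (Suc j)
    have v: "(k, 0, j) \<in> verts (ZT n h)" "(k, 0, Suc j) \<in> verts (ZT n h)" if "k = 0 \<or> k = 1" for k
      using Suc.prems that by (auto simp: ZT_verts_iff)
    have "\<gamma> (0, 0, Suc j) \<in> ?N (1, 0, j)"
      using Suc v n by (intro nb) (auto simp: ZT_neighbours)
    then have "\<gamma> (0, 0, Suc j) \<in> {(0, 0, j), (0, 0, Suc j), (0, 1, j)}"
      using Suc.prems n v by (auto simp: ZT_neighbours split: if_splits)
    moreover have "\<gamma> (0, 0, Suc j) \<noteq> (0, 0, j)"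
      using Suc Aut_eq_iff[OF \<gamma>, of "(0, 0, Suc j)" "(0, 0, j)"] by auto
    moreover have "\<gamma> (0, 0, Suc j) \<noteq> (0, 1, j)"
    proof
      assume "\<gamma> (0, 0, Suc j) = (0, 1, j)"
      moreover have "(0, 1, j) \<in> verts (ZT n h)" using Suc.prems n by (auto simp: ZT_verts_iff)
      ultimately show False
        using Aut_card_neighbours[OF \<gamma> v(2)[of 0]] ZT_degree[of h 0 0 "Suc j" n] ZT_degree[of h 0 1 j n] v h
        by auto
    qed
    ultimately have 0: "\<gamma> (0, 0, Suc j) = (0, 0, Suc j)" by auto
    have "\<gamma> (1, 0, Suc j) \<in> ?N (0, 0, Suc j)"
      using 0 v by (intro nb) (auto simp: ZT_neighbours_0)
    then have "\<gamma> (1, 0, Suc j) \<in> {(1, 0, Suc j), (1, 0, j)}"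
      using v by (auto simp: ZT_neighbours_0)
    moreover have "\<gamma> (1, 0, Suc j) \<noteq> (1, 0, j)"
      using Suc Aut_eq_iff[OF \<gamma>, of "(1, 0, Suc j)" "(1, 0, j)"] by auto
    ultimately show ?case using 0 by auto
  qed
  have layers: "\<forall>j<h. \<gamma> (0, i, j) = (0, i, j) \<and> \<gamma> (1, i, j) = (1, i, j)" if "i \<le> n" for i
    using that
  proof (induction i)
    case 0
    then show ?case using layer0 by blast
  next
    case (Suc i)
    then have IH: "\<gamma> (0, i, j) = (0, i, j)" "\<gamma> (1, i, j) = (1, i, j)" if "j < h" for j
      using that by auto
    have v: "(k, i, j) \<in> verts (ZT n h)" "(k, Suc i, j) \<in> verts (ZT n h)" if "k = 0 \<or> k = 1" "j < h" for k j
      using Suc.prems that by (auto simp: ZT_verts_iff)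
    have 0: "\<gamma> (0, Suc i, j) = (0, Suc i, j)" if j: "j < h" for j
    proof -
      have "\<gamma> (0, Suc i, j) \<in> ?N (1, i, j)"
        using Suc.prems IH v j by (intro nb) (auto simp: ZT_neighbours)
      then have "\<gamma> (0, Suc i, j) \<in> {(0, i, j), (0, i, (j + 1) mod h), (0, Suc i, j)}"
        using v j by (auto simp: ZT_neighbours split: if_splits)
      \<comment> \<open>The candidates in layer \<open>i\<close> are already fixed by
        \<open>\<gamma>\<close>, so injectivity leaves only the upper neighbour.\<close>
      moreover have "\<gamma> (0, Suc i, j) \<noteq> (0, i, l)" if "l < h" for l
        using IH(1)[OF that] Aut_eq_iff[OF \<gamma>, of "(0, Suc i, j)" "(0, i, l)"] by auto
      ultimately show ?thesis using j by auto
    qed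
    have 1: "\<gamma> (1, Suc i, j) = (1, Suc i, j)" if j: "j < h" for j
    proof -
      let ?j = "if j + 1 = h then 0 else j + 1"
      have j': "?j < h" using j by auto
      have "\<gamma> (1, Suc i, j) \<in> ?N (0, Suc i, j)"
        using 0 v j by (intro nb) (auto simp: ZT_neighbours_0)
      moreover have "\<gamma> (1, Suc i, j) \<in> ?N (0, Suc i, ?j)"
        using 0[OF j'] v(2)[OF _ j', of 0] by (intro nb) (auto simp: ZT_neighbours_0)
      ultimately show ?thesis
        using v(2)[OF _ j', of 0] v(2)[OF _ j, of 0] h j
        by (auto simp: ZT_neighbours_0 split: if_splits)
    qed
    show ?case using 0 1 by blast
  qed
  have "\<gamma> v = v" for v
  proof (cases "v \<in> verts (ZT n h)")
    case True
    then show ?thesis using layers by (cases v) (auto simp: ZT_verts_iff)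
  next
    case False
    then show ?thesis using Aut_permutes[OF \<gamma>] by (simp add: permutes_not_in)
  qed
  then show ?thesis by auto
qed

text \<open>The flag \<open>t\<close> says whether the tube is turned upside down, \<open>r\<close> whether the orientation of \<open>j\<close> is
  reversed, and \<open>s\<close> is a rotation. For \<open>r \<noteq> t\<close> the term \<open>k + i\<close> compensates the shift by half a hexagon
  between consecutive layers.\<close>

definition zt_auto_pos :: "nat \<Rightarrow> bool \<Rightarrow> bool \<Rightarrow> nat \<Rightarrow> nat \<times> nat \<times> nat \<Rightarrow> int" where
  "zt_auto_pos h t r s = (\<lambda>(k, i, j).
     int s + (if r then - 1 else 1) * (int j + (if r = t then 0 else int k + int i)))"

text \<open>Positions are reduced in the integers, since a reflection can make them negative.
  Outside of the vertex set the map is the identity, as \<open>permutes\<close> demands.\<close>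

definition zt_auto :: "nat \<Rightarrow> nat \<Rightarrow> bool \<Rightarrow> bool \<Rightarrow> nat \<Rightarrow> nat \<times> nat \<times> nat \<Rightarrow> nat \<times> nat \<times> nat" where
  "zt_auto n h t r s v =
     (if v \<in> verts (ZT n h)
      then (case v of (k, i, j) \<Rightarrow>
        (if t then 1 - k else k, if t then n - i else i, nat (zt_auto_pos h t r s v mod int h)))
      else v)"

section \<open>The explicit maps are automorphisms\<close>

text \<open>Divisibility of differences survives rotation and reduction modulo \<open>h\<close>, so
  that preservation of edges becomes linear arithmetic in the positions.\<close>

lemma zt_link_iff_dvd:
  assumes "j < h" "j' < h"
  shows "zt_link h i j i' j' \<longleftrightarrow>
    i' = i \<and> (int h dvd int j' - int j \<or> int h dvd int j' - int j - 1) \<or> i' = i + 1 \<and> int h dvd int j' - int j"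
proof -
  have "int h dvd int j' - int j \<longleftrightarrow> j' = j"
    using assms by (auto simp flip: mod_eq_dvd_iff)
  moreover have "int h dvd int j' - int j - 1 \<longleftrightarrow> j' = (j + 1) mod h"
  proof -
    have "int h dvd int j' - int j - 1 \<longleftrightarrow> int j' mod int h = int (j + 1) mod int h"
      by (simp add: mod_eq_dvd_iff algebra_simps)
    also have "\<dots> \<longleftrightarrow> j' = (j + 1) mod h"
      using assms by (simp only: zmod_int[symmetric] mod_less of_nat_eq_iff)
    finally show ?thesis .
  qed
  ultimately show ?thesis by (auto simp: zt_link_def)
qed

lemma dvd_mod_diff_iff: "(m::int) dvd x mod m - y mod m \<longleftrightarrow> m dvd x - y"
  "(m::int) dvd x mod m - y mod m - 1 \<longleftrightarrow> m dvd x - y - 1"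
  by (simp_all add: dvd_eq_mod_eq_0 mod_simps) (metis mod_diff_eq mod_diff_left_eq)

text \<open>Under \<open>t\<close> the images exchange types and the link is read in the opposite
  direction. For \<open>r = t\<close> the relevant difference of positions is unchanged; for
  \<open>r \<noteq> t\<close> the two divisibility conditions within a layer trade places, while the
  vertical one only changes sign.\<close>

lemma zt_auto_edge_10:
  assumes u: "(1, i, j) \<in> verts (ZT n h)" and v: "(0, i', j') \<in> verts (ZT n h)"
    and mem: "\<And>w. w \<in> verts (ZT n h) \<Longrightarrow> zt_auto n h t r s w \<in> verts (ZT n h)"
  shows "{zt_auto n h t r s (1, i, j), zt_auto n h t r s (0, i', j')} \<in> edges (ZT n h) \<longleftrightarrow> zt_link h i j i' j'"
proof -
  define x where "x = zt_auto_pos h t r s (1, i, j)"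
  define y where "y = zt_auto_pos h t r s (0, i', j')"
  have h: "h > 0" "i \<le> n" "i' \<le> n" "j < h" "j' < h" using u v by (auto simp: ZT_verts_iff)
  have bd: "nat (x mod int h) < h" "nat (y mod int h) < h" using h by (auto simp: nat_less_iff)
  have int_nat: "int (nat (x mod int h)) = x mod int h" "int (nat (y mod int h)) = y mod int h" using h by auto
  show ?thesis
  proof (cases t)
    case False
    have "{zt_auto n h t r s (1, i, j), zt_auto n h t r s (0, i', j')} \<in> edges (ZT n h) \<longleftrightarrow>
       zt_link h i (nat (x mod int h)) i' (nat (y mod int h))"
      using mem[OF u] mem[OF v] u v False by (simp add: zt_auto_def ZT_edge_iff x_def y_def)
    also have "\<dots> \<longleftrightarrow> i' = i \<and> (int h dvd y - x \<or> int h dvd y - x - 1) \<or> i' = i + 1 \<and> int h dvd y - x"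
      unfolding zt_link_iff_dvd[OF bd] int_nat dvd_mod_diff_iff ..
    also have "\<dots> \<longleftrightarrow> zt_link h i j i' j'"
    proof (cases r)
      case True
      have "i' = i \<Longrightarrow> y - x = - (int j' - int j - 1)" "i' = i \<Longrightarrow> y - x - 1 = - (int j' - int j)"
        "i' = i + 1 \<Longrightarrow> y - x = - (int j' - int j)"
        using True \<open>\<not> t\<close> by (simp_all add: x_def y_def zt_auto_pos_def)
      then show ?thesis unfolding zt_link_iff_dvd[OF h(4,5)] by (auto simp only: dvd_minus_iff)
    next
      case False
      then have "y - x = int j' - int j"
        using \<open>\<not> t\<close> by (simp add: x_def y_def zt_auto_pos_def)
      then show ?thesis unfolding zt_link_iff_dvd[OF h(4,5)] by simp
    qed
    finally show ?thesis .
  next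
    case True
    have "{zt_auto n h t r s (1, i, j), zt_auto n h t r s (0, i', j')} \<in> edges (ZT n h) \<longleftrightarrow>
       zt_link h (n - i') (nat (y mod int h)) (n - i) (nat (x mod int h))"
      using mem[OF u] mem[OF v] u v True by (simp add: zt_auto_def ZT_edge_iff x_def y_def)
    also have "\<dots> \<longleftrightarrow> i' = i \<and> (int h dvd x - y \<or> int h dvd x - y - 1) \<or> i' = i + 1 \<and> int h dvd x - y"
      unfolding zt_link_iff_dvd[OF bd(2,1)] int_nat dvd_mod_diff_iff using h(2,3) by auto
    also have "\<dots> \<longleftrightarrow> zt_link h i j i' j'"
    proof (cases r)
      case False
      have "i' = i \<Longrightarrow> x - y = - (int j' - int j - 1)" "i' = i \<Longrightarrow> x - y - 1 = - (int j' - int j)"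
        "i' = i + 1 \<Longrightarrow> x - y = - (int j' - int j)"
        using False \<open>t\<close> by (simp_all add: x_def y_def zt_auto_pos_def)
      then show ?thesis unfolding zt_link_iff_dvd[OF h(4,5)] by (auto simp only: dvd_minus_iff)
    next
      case True
      then have "x - y = int j' - int j"
        using \<open>t\<close> by (simp add: x_def y_def zt_auto_pos_def)
      then show ?thesis unfolding zt_link_iff_dvd[OF h(4,5)] by simp
    qed
    finally show ?thesis .
  qed
qed

lemma zt_auto_in_verts:
  assumes "v \<in> verts (ZT n h)"
  shows "zt_auto n h t r s v \<in> verts (ZT n h)"
proof (cases v)
  case (fields k i j)
  then have "h > 0" using assms by (auto simp: ZT_verts_iff)
  then have "nat (x mod int h) < h" for x by (simp add: nat_less_iff)
  then show ?thesis using assms fields by (auto simp: zt_auto_def ZT_verts_iff)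
qed

lemma zt_auto_inj_on: "inj_on (zt_auto n h t r s) (verts (ZT n h))"
proof (rule inj_onI)
  fix u v assume u: "u \<in> verts (ZT n h)" and v: "v \<in> verts (ZT n h)"
    and eq: "zt_auto n h t r s u = zt_auto n h t r s v"
  obtain k i j k' i' j' where uv: "u = (k, i, j)" "v = (k', i', j')" by (cases u; cases v)
  have b: "k = 0 \<or> k = 1" "k' = 0 \<or> k' = 1" "i \<le> n" "i' \<le> n" "j < h" "j' < h"
    using u v by (auto simp: uv ZT_verts_iff)
  have ki: "k = k'" "i = i'"
    using eq u v b by (auto simp: zt_auto_def uv split: if_splits)
  have "nat (zt_auto_pos h t r s u mod int h) = nat (zt_auto_pos h t r s v mod int h)"
    using eq u v by (simp add: zt_auto_def uv)
  then have "zt_auto_pos h t r s u mod int h = zt_auto_pos h t r s v mod int h"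
    using b by (subst (asm) eq_nat_nat_iff) auto
  then have "int h dvd zt_auto_pos h t r s u - zt_auto_pos h t r s v"
    by (simp add: mod_eq_dvd_iff)
  moreover have "zt_auto_pos h t r s u - zt_auto_pos h t r s v = (if r then - (int j - int j') else int j - int j')"
    by (simp add: zt_auto_pos_def uv ki)
  ultimately have "int h dvd int j - int j'"
    by (auto simp only: dvd_minus_iff split: if_splits)
  then have "j = j'" using b by (auto simp flip: mod_eq_dvd_iff)
  then show "u = v" using ki by (simp add: uv)
qed

lemma zt_auto_in_Aut: "zt_auto n h t r s \<in> Aut (ZT n h)"
proof -
  let ?f = "zt_auto n h t r s" and ?V = "verts (ZT n h)"
  have mem: "?f v \<in> ?V" if "v \<in> ?V" for v
    using that by (rule zt_auto_in_verts)
  have "?f ` ?V = ?V"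
    using zt_auto_inj_on mem by (intro endo_inj_surj finite_ZT_verts) auto
  then have "bij_betw ?f ?V ?V"
    using zt_auto_inj_on by (simp add: bij_betw_def)
  then have perm: "?f permutes ?V"
    by (rule bij_imp_permutes) (simp add: zt_auto_def)
  have "{?f u, ?f v} \<in> edges (ZT n h) \<longleftrightarrow> {u, v} \<in> edges (ZT n h)" if u: "u \<in> ?V" and v: "v \<in> ?V" for u v
  proof -
    obtain k i j k' i' j' where uv: "u = (k, i, j)" "v = (k', i', j')" by (cases u; cases v)
    have "k = 0 \<or> k = 1" "k' = 0 \<or> k' = 1" using u v by (auto simp: uv ZT_verts_iff)
    then consider "k = k'" | "k = 1" "k' = 0" | "k = 0" "k' = 1" by auto
    then show ?thesis
    proof cases
      case 1
      \<comment> \<open>Both images have the same type \<open>a\<close>, so neither pair is an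
        edge.\<close>
      obtain a b c d e where "?f u = (a, b, c)" "?f v = (a, d, e)"
        using u v 1 by (auto simp: uv zt_auto_def)
      then show ?thesis using mem[OF u] mem[OF v] u v 1 by (auto simp: uv ZT_edge_iff)
    next
      case 2
      then show ?thesis using zt_auto_edge_10[OF _ _ mem] u v by (auto simp: uv ZT_edge_iff)
    next
      case 3
      then show ?thesis using zt_auto_edge_10[OF _ _ mem, of i' j' i j] u v
        by (auto simp: uv ZT_edge_iff insert_commute)
    qed
  qed
  with perm show ?thesis by (auto simp: Aut_def)
qed

section \<open>Completeness of the list of automorphisms\<close>

text \<open>By rigidity an automorphism is determined by the image of the edge from
  \<open>(0, 0, 0)\<close> to \<open>(1, 0, 0)\<close>. The first end goes to one of the
  \<open>2 * h\<close> vertices of degree 2, the second to one of its two neighbours, and each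
  choice is realised by an explicit map.\<close>

lemma Aut_ZT_cases:
  assumes n: "n \<ge> 1" and h: "h \<ge> 3" and \<alpha>: "\<alpha> \<in> Aut (ZT n h)"
  obtains t r s where "s < h" "\<alpha> = zt_auto n h t r s"
proof -
  have v: "(0, 0, 0) \<in> verts (ZT n h)" "(1, 0, 0) \<in> verts (ZT n h)"
    using h by (auto simp: ZT_verts_iff)
  obtain k i a where \<alpha>0: "\<alpha> (0, 0, 0) = (k, i, a)" by (cases "\<alpha> (0, 0, 0)")
  have w: "(k, i, a) \<in> verts (ZT n h)" using Aut_verts[OF \<alpha>] v(1) \<alpha>0 by metis
  then have a: "a < h" by (simp add: ZT_verts_iff)
  have "card (neighbours (ZT n h) (k, i, a)) = 2"
    using Aut_card_neighbours[OF \<alpha> v(1)] ZT_degree[of h 0 0 0 n] h v \<alpha>0 by simp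
  then have ki: "k = 0 \<and> i = 0 \<or> k = 1 \<and> i = n"
    using ZT_degree[OF _ w] h by (auto split: if_splits)
  have "\<alpha> (1, 0, 0) \<in> neighbours (ZT n h) (k, i, a)"
    using Aut_neighbours[OF \<alpha> v(1)] v by (auto simp: \<alpha>0 ZT_neighbours_0)
  then have \<alpha>1: "\<alpha> (1, 0, 0) \<in> (if k = 0 then {(1, 0, a), (1, 0, if a = 0 then h - 1 else a - 1)}
      else {(0, n, a), (0, n, (a + 1) mod h)})"
    using ki w by (auto simp: ZT_neighbours split: if_splits)
  have pred: "nat ((int a - 1) mod int h) = (if a = 0 then h - 1 else a - 1)"
  proof (cases "a = 0")
    case True
    then show ?thesis using h by (simp add: zmod_minus1 nat_diff_distrib)
  next
    case False
    then show ?thesis using a by (simp add: mod_pos_pos_trivial)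
  qed
  have suc: "nat ((int a + 1) mod int h) = (a + 1) mod h"
    by (metis nat_int of_nat_1 of_nat_add zmod_int)
  \<comment> \<open>Composing \<open>\<alpha>\<close> with the inverse of an explicit map that
    agrees with it on this edge fixes both ends, so the composition is \<open>id\<close>.\<close>
  have eqI: "\<alpha> = zt_auto n h t r a"
    if "zt_auto n h t r a (0, 0, 0) = \<alpha> (0, 0, 0)" "zt_auto n h t r a (1, 0, 0) = \<alpha> (1, 0, 0)" for t r
  proof -
    let ?f = "zt_auto n h t r a"
    have p: "?f permutes verts (ZT n h)" by (rule Aut_permutes[OF zt_auto_in_Aut])
    have "inv ?f \<circ> \<alpha> \<in> Aut (ZT n h)"
      by (intro Aut_comp Aut_inv zt_auto_in_Aut \<alpha>)
    moreover have "inv ?f (\<alpha> (0, 0, 0)) = (0, 0, 0)" "inv ?f (\<alpha> (1, 0, 0)) = (1, 0, 0)"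
      unfolding that[symmetric] by (rule permutes_inverses(2)[OF p])+
    ultimately have "inv ?f \<circ> \<alpha> = id"
      by (intro ZT_automorphism_rigid[OF n h]) simp_all
    then have "?f (inv ?f (\<alpha> x)) = ?f x" for x by (metis comp_apply id_apply)
    then show ?thesis by (auto simp: permutes_inverses[OF p])
  qed
  \<comment> \<open>The rotation is \<open>a\<close>, the type \<open>k\<close> of the image
    dictates \<open>t\<close>, and the choice between the two neighbours dictates
    \<open>r\<close>.\<close>
  have "\<exists>t r. zt_auto n h t r a (0, 0, 0) = \<alpha> (0, 0, 0) \<and> zt_auto n h t r a (1, 0, 0) = \<alpha> (1, 0, 0)"
  proof (cases "k = 0")
    case True
    then consider "\<alpha> (1, 0, 0) = (1, 0, a)" | "\<alpha> (1, 0, 0) = (1, 0, if a = 0 then h - 1 else a - 1)"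
      using \<alpha>1 by auto
    then show ?thesis
    proof cases
      case 1
      show ?thesis
        using 1 True \<alpha>0 ki v a n by (intro exI[of _ False]) (auto simp: zt_auto_def zt_auto_pos_def)
    next
      case 2
      show ?thesis
        unfolding 2
        using True \<alpha>0 ki v a n by (intro exI[of _ False] exI[of _ True]) (auto simp: zt_auto_def zt_auto_pos_def pred)
    qed
  next
    case False
    then consider "\<alpha> (1, 0, 0) = (0, n, a)" | "\<alpha> (1, 0, 0) = (0, n, (a + 1) mod h)"
      using \<alpha>1 by auto
    then show ?thesis
    proof cases
      case 1
      show ?thesis
        using 1 False \<alpha>0 ki v a n by (intro exI[of _ True]) (auto simp: zt_auto_def zt_auto_pos_def)
    next
      case 2
      show ?thesis
        unfolding 2
        using False \<alpha>0 ki v a n by (intro exI[of _ True] exI[of _ False]) (auto simp: zt_auto_def zt_auto_pos_def suc)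
    qed
  qed
  then show ?thesis using that a eqI by blast
qed

text \<open>The image of \<open>(0, 0, 0)\<close> reveals \<open>t\<close> by its type and
  \<open>s\<close> by its position. For given \<open>t\<close> and \<open>s\<close>, the two values
  of \<open>r\<close> send \<open>(1, 0, 0)\<close> to positions that differ by one modulo
  \<open>h\<close>.\<close>

lemma zt_auto_inject:
  assumes h: "h \<ge> 3" and s: "s < h" "s' < h" and eq: "zt_auto n h t r s = zt_auto n h t' r' s'"
  shows "t = t' \<and> r = r' \<and> s = s'"
proof -
  have v: "(0, 0, 0) \<in> verts (ZT n h)" "(1, 0, 0) \<in> verts (ZT n h)"
    using h by (auto simp: ZT_verts_iff)
  have ts: "t = t' \<and> s = s'"
    using fun_cong[OF eq, of "(0, 0, 0)"] v s by (auto simp: zt_auto_def zt_auto_pos_def split: if_splits)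
  have "r = r'"
  proof (rule ccontr)
    assume "r \<noteq> r'"
    then have "nat (int s mod int h) = nat ((int s - 1) mod int h) \<or>
        nat (int s mod int h) = nat ((int s + 1) mod int h)"
      using fun_cong[OF eq, of "(1, 0, 0)"] v s ts h
      by (cases r; cases t) (auto simp: zt_auto_def zt_auto_pos_def)
    then have "int s mod int h = (int s - 1) mod int h \<or> int s mod int h = (int s + 1) mod int h"
      using h by (subst (asm) (1 2) eq_nat_nat_iff) auto
    then have "int h dvd 1" by (auto simp: mod_eq_dvd_iff)
    then show False using h by simp
  qed
  with ts show ?thesis by simp
qed

text \<open>The summand is kept general because the constant \<open>1\<close> later gives the group
  order and the distances give the index.\<close>

lemma sum_Aut_ZT:
  fixes g :: "_ \<Rightarrow> 'b::comm_monoid_add"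
  assumes n: "n \<ge> 1" and h: "h \<ge> 3"
  shows "(\<Sum>\<alpha>\<in>Aut (ZT n h). g \<alpha>) = (\<Sum>t\<in>UNIV. \<Sum>r\<in>UNIV. \<Sum>s<h. g (zt_auto n h t r s))"
proof -
  let ?f = "\<lambda>x. case x of (t, r, s) \<Rightarrow> zt_auto n h t r s"
  have "bij_betw ?f (UNIV \<times> UNIV \<times> {..<h}) (Aut (ZT n h))"
    unfolding bij_betw_def
  proof
    show "inj_on ?f (UNIV \<times> UNIV \<times> {..<h})"
    proof (rule inj_onI)
      fix x y assume "x \<in> UNIV \<times> UNIV \<times> {..<h}" "y \<in> UNIV \<times> UNIV \<times> {..<h}" "?f x = ?f y"
      then show "x = y"
        using zt_auto_inject[OF h, of "snd (snd x)" "snd (snd y)" n "fst x" "fst (snd x)" "fst y" "fst (snd y)"]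
        by (cases x; cases y) simp
    qed
    show "?f ` (UNIV \<times> UNIV \<times> {..<h}) = Aut (ZT n h)"
    proof
      show "Aut (ZT n h) \<subseteq> ?f ` (UNIV \<times> UNIV \<times> {..<h})"
      proof
        fix \<alpha> assume "\<alpha> \<in> Aut (ZT n h)"
        then obtain t r s where "s < h" "\<alpha> = zt_auto n h t r s" by (rule Aut_ZT_cases[OF n h])
        then show "\<alpha> \<in> ?f ` (UNIV \<times> UNIV \<times> {..<h})" by (intro image_eqI[of _ _ "(t, r, s)"]) auto
      qed
    qed (auto simp: zt_auto_in_Aut)
  qed
  then have "(\<Sum>\<alpha>\<in>Aut (ZT n h). g \<alpha>) = (\<Sum>x\<in>UNIV \<times> UNIV \<times> {..<h}. g (?f x))"
    by (rule sum.reindex_bij_betw[symmetric])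
  also have "\<dots> = (\<Sum>t\<in>UNIV. \<Sum>r\<in>UNIV. \<Sum>s<h. g (zt_auto n h t r s))"
    by (simp only: sum.cartesian_product split_def fst_conv snd_conv)
  finally show ?thesis .
qed

section \<open>Sums of cyclic distances\<close>

text \<open>Moving the window by one drops \<open>G c\<close> and gains
  \<open>G (c + int h)\<close>, which are equal.\<close>

lemma sum_periodic_shift:
  fixes G :: "int \<Rightarrow> 'a::ab_group_add"
  assumes "\<And>x. G (x + int h) = G x"
  shows "(\<Sum>s<h. G (int s + c)) = (\<Sum>s<h. G (int s))"
proof (induction c rule: int_induct[of _ 0])
  have step: "(\<Sum>s<h. G (int s + (i + 1))) = (\<Sum>s<h. G (int s + i))" for i
  proof -
    have "G i + (\<Sum>s<h. G (int s + (i + 1))) = (\<Sum>s<Suc h. G (int s + i))"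
      by (subst sum.lessThan_Suc_shift) (simp add: add_ac)
    also have "\<dots> = (\<Sum>s<h. G (int s + i)) + G i"
      using assms[of i] by (simp add: add_ac)
    finally show ?thesis by (simp add: add.commute)
  qed
  {
    case base
    show ?case by simp
  next
    case (step1 i)
    then show ?case using step by simp
  next
    case (step2 i)
    then show ?case using step[of "i - 1"] by simp
  }
qed

text \<open>Both end terms vanish, and the inner terms for \<open>N + 2\<close> are those for
  \<open>N\<close> raised by one, whence the induction in steps of two.\<close>

lemma sum_min_reflect:
  "4 * (\<Sum>t<N. min (int t) (int N - 1 - int t)) = (int N - 1)\<^sup>2 - (if even N then 1 else 0)"
proof (induction N rule: nat_induct2)
  case (step N)
  have "(\<Sum>t<N + 2. min (int t) (int (N + 2) - 1 - int t))
      = (\<Sum>t<N. min (int (Suc t)) (int (N + 2) - 1 - int (Suc t)))"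
    by (simp add: sum.lessThan_Suc_shift[of _ "Suc N"] del: sum.lessThan_Suc)
       (simp add: add.commute)
  also have "\<dots> = (\<Sum>t<N. 1 + min (int t) (int N - 1 - int t))"
    by (intro sum.cong) auto
  also have "\<dots> = int N + (\<Sum>t<N. min (int t) (int N - 1 - int t))"
    by (simp add: sum.distrib)
  finally show ?case using step.IH by (simp add: power2_eq_square algebra_simps)
qed auto

section \<open>Distances to a half layer\<close>

text \<open>Total of the non-vertical parts of the distances from one vertex to all vertices of a
  fixed type in a fixed layer; \<open>2 * int s + y\<close> runs through the residues modulo
  \<open>2 * int h\<close> with the parity of \<open>y\<close>.\<close>

definition cyc_sum :: "nat \<Rightarrow> int \<Rightarrow> int" where
  "cyc_sum h y = (\<Sum>s<h. max (cyc (2 * int h) (2 * int s + y)) \<bar>y\<bar>)"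

text \<open>An even change of the offset is a rotation of \<open>s\<close>, so only its parity
  matters.\<close>

lemma cyc_sum_shift:
  assumes "even (c - y)"
  shows "(\<Sum>s<h. max (cyc (2 * int h) (2 * int s + c)) \<bar>y\<bar>) = cyc_sum h y"
proof -
  obtain d where "c - y = 2 * d" using assms by (rule evenE)
  then have d: "c = y + 2 * d" by simp
  define G where "G x = max (cyc (2 * int h) (2 * x + y)) \<bar>y\<bar>" for x
  have period: "G (x + int h) = G x" for x
    using cyc_add_period(1)[of "2 * int h" "2 * x + y"] by (simp add: G_def algebra_simps)
  show ?thesis
    using sum_periodic_shift[of G h d, OF period] by (simp add: G_def d cyc_sum_def algebra_simps)
qed

lemma cyc_sum_large:
  assumes "int h \<le> \<bar>y\<bar>"
  shows "cyc_sum h y = int h * \<bar>y\<bar>"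
proof -
  have "max (cyc (2 * int h) z) \<bar>y\<bar> = \<bar>y\<bar>" for z
    using cyc_le_half[of "2 * int h" z] assms by linarith
  then show ?thesis by (simp add: cyc_sum_def)
qed

text \<open>The residues split into those within cyclic distance \<open>\<bar>y\<bar>\<close> of
  \<open>0\<close>, where the maximum is constant, and the rest, where the cyclic distance rises and
  falls symmetrically as in \<open>sum_min_reflect\<close>.\<close>

lemma cyc_sum_small:
  assumes y: "\<bar>y\<bar> < int h"
  shows "2 * cyc_sum h y = (int h)\<^sup>2 + y\<^sup>2 - (if even (int h - y) then 0 else 1)"
proof -
  define m where "m = nat \<bar>y\<bar>"
  have m: "int m = \<bar>y\<bar>" "m < h" using y by (auto simp: m_def)
  define N where "N = h - 1 - m"
  have hN: "h = Suc m + N" using m by (simp add: N_def)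
  have "even (- int m - y)" using m by (cases "y \<ge> 0") auto
  \<comment> \<open>Starting at \<open>- int m\<close>, which has the parity of \<open>y\<close>,
    puts the residues of the first kind at the beginning.\<close>
  define g where "g s = max (cyc (2 * int h) (2 * int s + - int m)) \<bar>y\<bar>" for s
  have "cyc_sum h y = (\<Sum>s<h. g s)"
    using cyc_sum_shift[OF \<open>even (- int m - y)\<close>, of h] by (simp only: g_def)
  also have "\<dots> = (\<Sum>s<Suc m. g s) + (\<Sum>t<N. g (Suc m + t))"
    unfolding hN by (induction N) (simp_all add: add.assoc)
  \<comment> \<open>These are the residues \<open>- m, - m + 2, ..., m\<close>.\<close>
  also have "(\<Sum>s<Suc m. g s) = (\<Sum>s<Suc m. int m)"
  proof (rule sum.cong)
    fix s assume s: "s \<in> {..<Suc m}"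
    have "cyc (2 * int h) (2 * int s + - int m) \<le> int m"
    proof (cases "2 * s \<ge> m")
      case True
      then have "(2 * int s + - int m) mod (2 * int h) = 2 * int s + - int m"
        using s m by (intro mod_pos_pos_trivial) auto
      then show ?thesis using s by (auto simp: cyc_def)
    next
      case False
      then have "(2 * int s + - int m + 2 * int h) mod (2 * int h) = 2 * int s + - int m + 2 * int h"
        using s m by (intro mod_pos_pos_trivial) auto
      then have "(2 * int s + - int m) mod (2 * int h) = 2 * int s + - int m + 2 * int h"
        by (simp only: mod_add_self2)
      then show ?thesis using s by (auto simp: cyc_def)
    qed
    then show "g s = int m" using m by (simp add: g_def)
  qed simp
  \<comment> \<open>These are the residues \<open>m + 2, m + 4, ..., 2 * h - m - 2\<close>, a range
    symmetric about \<open>h\<close>.\<close>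
  also have "(\<Sum>t<N. g (Suc m + t)) = (\<Sum>t<N. int m + 2 + 2 * min (int t) (int N - 1 - int t))"
  proof (rule sum.cong)
    fix t assume t: "t \<in> {..<N}"
    have "(2 * int (Suc m + t) + - int m) mod (2 * int h) = 2 * int (Suc m + t) + - int m"
      using t hN by (intro mod_pos_pos_trivial) auto
    then have "cyc (2 * int h) (2 * int (Suc m + t) + - int m)
        = min (2 * int (Suc m + t) + - int m) (2 * int h - (2 * int (Suc m + t) + - int m))"
      by (simp only: cyc_def)
    also have "\<dots> = int m + 2 + 2 * min (int t) (int N - 1 - int t)"
      unfolding hN by (simp add: min_def)
    finally show "g (Suc m + t) = int m + 2 + 2 * min (int t) (int N - 1 - int t)"
      using t m by (simp add: g_def)
  qed simp
  finally have "2 * cyc_sum h y = 2 * int (Suc m) * int m + 2 * int N * (int m + 2)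
      + 4 * (\<Sum>t<N. min (int t) (int N - 1 - int t))"
    by (simp add: sum.distrib sum_distrib_left algebra_simps)
  also have "\<dots> = 2 * int (Suc m) * int m + 2 * int N * (int m + 2) + (int N - 1)\<^sup>2 - (if even N then 1 else 0)"
    by (simp add: sum_min_reflect)
  also have "even N \<longleftrightarrow> odd (int h - y)"
  proof -
    have "even N \<longleftrightarrow> odd (int h - int m)" unfolding hN by simp
    then show ?thesis using m by (cases "y \<ge> 0") auto
  qed
  also have "2 * int (Suc m) * int m + 2 * int N * (int m + 2) + (int N - 1)\<^sup>2 = (int h)\<^sup>2 + (int m)\<^sup>2"
    unfolding hN by (simp add: power2_eq_square algebra_simps)
  finally show ?thesis using m(1) by simp
qed

lemma cyc_sum_0: "h > 0 \<Longrightarrow> 2 * cyc_sum h 0 = (int h)\<^sup>2 - (if even h then 0 else 1)"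
  using cyc_sum_small[of 0 h] by simp

text \<open>At \<open>\<bar>y\<bar> = int h\<close> both closed forms give the square of
  \<open>h\<close>.\<close>

lemma cyc_sum_small_le:
  assumes "h > 0" "\<bar>y\<bar> \<le> int h"
  shows "2 * cyc_sum h y = (int h)\<^sup>2 + y\<^sup>2 - (if even (int h - y) then 0 else 1)"
proof (cases "\<bar>y\<bar> = int h")
  case True
  then have "y = int h \<or> y = - int h" by auto
  then show ?thesis using cyc_sum_large[of h y] True by (auto simp: power2_eq_square)
qed (use assms cyc_sum_small in auto)

text \<open>At \<open>\<bar>y\<bar> = int h - 1\<close> the parity correction applies, and the
  quadratic form collapses to \<open>h * (h - 1)\<close>. The two closed forms thus overlap at
  \<open>h - 1\<close> and \<open>h\<close>.\<close>

lemma cyc_sum_large_le: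
  assumes "h > 0" "int h - 1 \<le> \<bar>y\<bar>"
  shows "cyc_sum h y = int h * \<bar>y\<bar>"
proof (cases "\<bar>y\<bar> = int h - 1")
  case True
  then have y: "y = int h - 1 \<or> y = 1 - int h" by linarith
  then have odd: "odd (int h - y)" by auto
  have h: "int h = \<bar>y\<bar> + 1" using True by simp
  have "2 * cyc_sum h y = (int h)\<^sup>2 + \<bar>y\<bar>\<^sup>2 - 1"
    using cyc_sum_small[of y h] odd h unfolding power2_abs by simp
  also have "\<dots> = 2 * (int h * \<bar>y\<bar>)"
    unfolding h by (simp only: power2_eq_square) (simp add: algebra_simps)
  finally show ?thesis by simp
qed (use assms cyc_sum_large in auto)

lemma cyc_sum_uminus: "h > 0 \<Longrightarrow> cyc_sum h (- y) = cyc_sum h y"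
  using cyc_sum_small[of y h] cyc_sum_small[of "- y" h] cyc_sum_large[of h y] cyc_sum_large[of h "- y"]
  by (cases "\<bar>y\<bar> < int h") auto

text \<open>Going from \<open>n\<close> to \<open>n + 2\<close> adds one argument at each end of the range of \<open>n + c - 2 i\<close>.\<close>

lemma sum_layers_step:
  fixes f :: "int \<Rightarrow> int"
  shows "(\<Sum>i\<le>n + 2. f (int (n + 2) + c - 2 * int i)) =
    f (int n + 2 + c) + (\<Sum>i\<le>n. f (int n + c - 2 * int i)) + f (c - int n - 2)"
proof -
  have "(\<Sum>i\<le>n + 2. f (int (n + 2) + c - 2 * int i)) =
      f (int n + 2 + c) + (\<Sum>i\<le>Suc n. f (int (n + 2) + c - 2 * int (Suc i)))"
    by (simp add: sum.atMost_Suc_shift del: sum.atMost_Suc) (simp add: algebra_simps)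
  also have "(\<Sum>i\<le>Suc n. f (int (n + 2) + c - 2 * int (Suc i))) =
      (\<Sum>i\<le>n. f (int n + c - 2 * int i)) + f (c - int n - 2)"
    by (simp add: algebra_simps)
  finally show ?thesis by simp
qed

section \<open>Sums over the layers\<close>

lemma sum_abs_layers:
  "2 * (\<Sum>i\<le>n. \<bar>int n - 2 * int i\<bar>) = (int n + 1)\<^sup>2 - (if even n then 1 else 0)"
proof (induction n rule: nat_induct2)
  case (step n)
  then show ?case
    using sum_layers_step[of "\<lambda>x. \<bar>x\<bar>" n 0] by (simp add: power2_eq_square algebra_simps)
qed auto

lemma sum_square_layers:
  "3 * (\<Sum>i\<le>n. (int n + 1 - 2 * int i)\<^sup>2) = (int n + 1) * ((int n + 1)\<^sup>2 + 2)"
proof (induction n rule: nat_induct2)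
  case (step n)
  then show ?case
    using sum_layers_step[of "\<lambda>x. x\<^sup>2" n 1] by (simp add: power2_eq_square algebra_simps)
qed auto

text \<open>All arguments are at most \<open>n + 1 \<le> h\<close> in absolute value, so the
  quadratic form applies throughout. They share the parity of \<open>n + 1\<close>, which makes the
  correction constant.\<close>

lemma sum_cyc_sum_short:
  assumes "h > 0" "n + 1 \<le> h"
  shows "6 * (\<Sum>i\<le>n. cyc_sum h (int n + 1 - 2 * int i)) =
    (int n + 1) * (3 * (int h)\<^sup>2 + (int n + 1)\<^sup>2 + 2 - (if even (h + n) then 3 else 0))"
proof -
  define d :: int where "d = (if even (h + n) then 1 else 0)"
  have "2 * (\<Sum>i\<le>n. cyc_sum h (int n + 1 - 2 * int i)) =
      (\<Sum>i\<le>n. (int h)\<^sup>2 + (int n + 1 - 2 * int i)\<^sup>2 - d)"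
    unfolding sum_distrib_left
  proof (rule sum.cong)
    fix i assume "i \<in> {..n}"
    then have "\<bar>int n + 1 - 2 * int i\<bar> \<le> int h" using assms by auto
    moreover have "even (int h - (int n + 1 - 2 * int i)) \<longleftrightarrow> odd (h + n)" by auto
    ultimately show "2 * cyc_sum h (int n + 1 - 2 * int i) = (int h)\<^sup>2 + (int n + 1 - 2 * int i)\<^sup>2 - d"
      using cyc_sum_small_le[OF assms(1)] by (simp only: d_def if_not_P) auto
  qed simp
  also have "\<dots> = (int n + 1) * (int h)\<^sup>2 + (\<Sum>i\<le>n. (int n + 1 - 2 * int i)\<^sup>2) - (int n + 1) * d"
    by (simp add: sum.distrib sum_subtractf algebra_simps)
  finally have "6 * (\<Sum>i\<le>n. cyc_sum h (int n + 1 - 2 * int i)) =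
      3 * ((int n + 1) * (int h)\<^sup>2) + 3 * (\<Sum>i\<le>n. (int n + 1 - 2 * int i)\<^sup>2) - 3 * ((int n + 1) * d)"
    by simp
  also have "\<dots> = (int n + 1) * (3 * (int h)\<^sup>2 + (int n + 1)\<^sup>2 + 2 - 3 * d)"
    unfolding sum_square_layers by (simp add: algebra_simps)
  finally show ?thesis by (cases "even (h + n)") (simp_all only: d_def if_True if_False, simp_all)
qed

text \<open>Induction in steps of two, starting from \<open>h = n + 1\<close> and
  \<open>h = n + 2\<close>, where the short formula still holds; each further step adds two terms of
  the linear form.\<close>

lemma sum_cyc_sum_long:
  assumes "h \<ge> 2" "h \<le> n + 2"
  shows "6 * (\<Sum>i\<le>n. cyc_sum h (int n + 1 - 2 * int i)) =
    3 * int h * (int n + 1)\<^sup>2 + (int h) ^ 3 + 2 * int h - (if even (h + n) then 3 * int h else 0)"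
  using assms(2)
proof (induction n rule: less_induct)
  case (less n)
  show ?case
  proof (cases "n + 1 \<le> h")
    case True
    then consider "h = n + 1" | "h = n + 2" using less.prems by linarith
    then show ?thesis
      using sum_cyc_sum_short[of h n] assms(1) True
      by cases (simp_all add: power2_eq_square power3_eq_cube algebra_simps)
  next
    case False
    then obtain m where n: "n = m + 2" using assms(1) by (intro that[of "n - 2"]) auto
    \<comment> \<open>The smaller new argument has absolute value \<open>m + 1\<close>, which is
      only known to be at least \<open>h - 1\<close>; this is where the extended range of
      \<open>cyc_sum_large_le\<close> is needed.\<close>
    have c: "cyc_sum h (int m + 2 + 1) = int h * (int m + 3)" "cyc_sum h (1 - int m - 2) = int h * (int m + 1)"
      using n False cyc_sum_large_le[of h "int m + 2 + 1"] cyc_sum_large_le[of h "1 - int m - 2"] assms(1) by auto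
    have "6 * (\<Sum>i\<le>n. cyc_sum h (int n + 1 - 2 * int i)) =
        6 * (\<Sum>i\<le>m. cyc_sum h (int m + 1 - 2 * int i)) + 6 * (int h * (int m + 3)) + 6 * (int h * (int m + 1))"
      unfolding n sum_layers_step[of "cyc_sum h" m 1] c by simp
    also have "6 * (\<Sum>i\<le>m. cyc_sum h (int m + 1 - 2 * int i)) =
        3 * int h * (int m + 1)\<^sup>2 + (int h) ^ 3 + 2 * int h - (if even (h + m) then 3 * int h else 0)"
      using less.IH[of m] n False by simp
    finally show ?thesis
      unfolding n by (simp add: power2_eq_square algebra_simps)
  qed
qed

section \<open>The index\<close>

lemma cyc_mod_half: "cyc (2 * m) (2 * (x mod m - a) + y) = cyc (2 * m) (2 * x + (y - 2 * a))"
proof -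
  define q r where "q = x div m" and "r = x mod m"
  have x: "x = m * q + r" by (simp add: q_def r_def)
  have "2 * (r - a) + y = 2 * x + (y - 2 * a) + 2 * m * (- q)"
    unfolding x by (simp add: algebra_simps)
  then show ?thesis unfolding cyc_def r_def by (simp only: mod_mult_self2)
qed

text \<open>Without \<open>t\<close> the image stays in the same half layer, so layer difference and
  \<open>y\<close> vanish. With \<open>t\<close> they are \<open>n - 2 * i\<close> and
  \<open>n + 1 - 2 * i - 2 * k\<close>. The flag \<open>r\<close> only changes the offset of the
  rotation, which the sum over \<open>s\<close> absorbs.\<close>

lemma sum_rotations_dist:
  assumes v: "(k, i, j) \<in> verts (ZT n h)"
  shows "(\<Sum>s<h. int (graph_dist (ZT n h) (k, i, j) (zt_auto n h t r s (k, i, j)))) =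
    (if t then int h * \<bar>int n - 2 * int i\<bar> + cyc_sum h (int n + 1 - 2 * int i - 2 * int k) else cyc_sum h 0)"
proof -
  have h: "h > 0" and k: "k \<le> 1" and i: "i \<le> n" using v by (auto simp: ZT_verts_iff)
  define D where "D = (if t then int n - 2 * int i else 0)"
  define y where "y = (if t then int n + 1 - 2 * int i - 2 * int k else 0)"
  define c where "c = zt_auto_pos h t r 0 (k, i, j)"
  have pos: "zt_auto_pos h t r s (k, i, j) = int s + c" for s
    by (simp add: zt_auto_pos_def c_def)
  have "int (graph_dist (ZT n h) (k, i, j) (zt_auto n h t r s (k, i, j))) =
      \<bar>D\<bar> + max (cyc (2 * int h) (2 * int s + (y + 2 * (c - int j)))) \<bar>y\<bar>" for s
  proof -
    have "int (graph_dist (ZT n h) (k, i, j) (zt_auto n h t r s (k, i, j))) =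
        zt_dist h (k, i, j) (zt_auto n h t r s (k, i, j))"
      using ZT_graph_dist[OF h v zt_auto_in_verts[OF v]] zt_dist_nonneg[OF h] by simp
    also have "\<dots> = \<bar>D\<bar> + max (cyc (2 * int h) (2 * ((int s + c) mod int h - int j) + y)) \<bar>y\<bar>"
      using h k i v
      by (simp add: zt_auto_def zt_dist_def Let_def pos D_def y_def of_nat_diff algebra_simps)
    also have "\<dots> = \<bar>D\<bar> + max (cyc (2 * int h) (2 * int s + (y + 2 * (c - int j)))) \<bar>y\<bar>"
      unfolding cyc_mod_half by (simp add: algebra_simps)
    finally show ?thesis .
  qed
  then have "(\<Sum>s<h. int (graph_dist (ZT n h) (k, i, j) (zt_auto n h t r s (k, i, j)))) =
      int h * \<bar>D\<bar> + (\<Sum>s<h. max (cyc (2 * int h) (2 * int s + (y + 2 * (c - int j)))) \<bar>y\<bar>)"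
    by (simp add: sum.distrib)
  also have "(\<Sum>s<h. max (cyc (2 * int h) (2 * int s + (y + 2 * (c - int j)))) \<bar>y\<bar>) = cyc_sum h y"
    by (rule cyc_sum_shift) simp
  finally show ?thesis by (simp add: D_def y_def)
qed

lemma sum_Aut_dist:
  assumes n: "n \<ge> 1" and h: "h \<ge> 3" and v: "(k, i, j) \<in> verts (ZT n h)"
  shows "(\<Sum>\<alpha>\<in>Aut (ZT n h). int (graph_dist (ZT n h) (k, i, j) (\<alpha> (k, i, j)))) =
    2 * (cyc_sum h 0 + int h * \<bar>int n - 2 * int i\<bar> + cyc_sum h (int n + 1 - 2 * int i - 2 * int k))"
  unfolding sum_Aut_ZT[OF n h] sum_rotations_dist[OF v] by (simp add: UNIV_bool)

lemma sum_dist_ZT: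
  assumes n: "n \<ge> 1" and h: "h \<ge> 3"
  shows "(\<Sum>u\<in>verts (ZT n h). \<Sum>\<alpha>\<in>Aut (ZT n h). int (graph_dist (ZT n h) u (\<alpha> u))) =
    4 * int h * ((int n + 1) * cyc_sum h 0 + int h * (\<Sum>i\<le>n. \<bar>int n - 2 * int i\<bar>)
      + (\<Sum>i\<le>n. cyc_sum h (int n + 1 - 2 * int i)))"
proof -
  define g where "g k i = 2 * (cyc_sum h 0 + int h * \<bar>int n - 2 * int i\<bar> + cyc_sum h (int n + 1 - 2 * int i - 2 * int k))"
    for k i
  have "(\<Sum>u\<in>verts (ZT n h). \<Sum>\<alpha>\<in>Aut (ZT n h). int (graph_dist (ZT n h) u (\<alpha> u))) =
      (\<Sum>(k, i, j)\<in>verts (ZT n h). g k i)"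
    using sum_Aut_dist[OF n h] by (intro sum.cong) (auto simp: g_def)
  also have "\<dots> = (\<Sum>(k, i, j)\<in>{0, 1} \<times> {..n} \<times> {..<h}. g k i)"
    by (simp add: ZT_def atLeast0AtMost atLeast0LessThan)
  also have "\<dots> = (\<Sum>k\<in>{0, 1}. \<Sum>i\<le>n. \<Sum>j<h. g k i)"
    by (simp only: sum.cartesian_product split_def fst_conv snd_conv)
  also have "\<dots> = int h * ((\<Sum>i\<le>n. g 0 i) + (\<Sum>i\<le>n. g 1 i))"
    by (simp add: sum_distrib_left algebra_simps)
  \<comment> \<open>Turning the tube upside down matches type 1 in layer \<open>n - i\<close> with
    type 0 in layer \<open>i\<close>; the arguments change sign, and \<open>cyc_sum\<close> is
    even.\<close>
  also have "(\<Sum>i\<le>n. g 1 i) = (\<Sum>i\<le>n. g 0 i)"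
  proof -
    have "(\<Sum>i\<le>n. g 1 i) = (\<Sum>i\<le>n. g 1 (n - i))"
      by (rule sum.reindex_bij_witness[of _ "\<lambda>i. n - i" "\<lambda>i. n - i"]) auto
    also have "\<dots> = (\<Sum>i\<le>n. g 0 i)"
    proof (rule sum.cong)
      fix i assume "i \<in> {..n}"
      then have "int n + 1 - 2 * int (n - i) - 2 * int 1 = - (int n + 1 - 2 * int i - 2 * int 0)"
        "int n - 2 * int (n - i) = - (int n - 2 * int i)"
        by auto
      then show "g 1 (n - i) = g 0 i"
        using h unfolding g_def by (simp only: cyc_sum_uminus abs_minus_cancel)
    qed simp
    finally show ?thesis .
  qed
  also have "(\<Sum>i\<le>n. g 0 i) = 2 * ((int n + 1) * cyc_sum h 0 + int h * (\<Sum>i\<le>n. \<bar>int n - 2 * int i\<bar>)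
      + (\<Sum>i\<le>n. cyc_sum h (int n + 1 - 2 * int i)))"
    by (simp add: g_def sum.distrib sum_distrib_left[symmetric])
  finally show ?thesis by (simp add: algebra_simps)
qed

lemma card_Aut_ZT:
  assumes n: "n \<ge> 1" and h: "h \<ge> 3"
  shows "card (Aut (ZT n h)) = 4 * h"
  using sum_Aut_ZT[OF n h, of "\<lambda>_. 1 :: nat"] by (simp add: UNIV_bool)

lemma GP_index_ZT:
  assumes n: "n \<ge> 1" and h: "h \<ge> 3"
  shows "GP_index (ZT n h) = real h * (real n + 1) / 6 *
    (3 * (real n + 1) * ((real h)\<^sup>2 - (if even h then 0 else 1))
     + 3 * real h * ((real n + 1)\<^sup>2 - (if even n then 1 else 0))
     + real_of_int (6 * (\<Sum>i\<le>n. cyc_sum h (int n + 1 - 2 * int i))))"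
proof -
  define S where "S = (\<Sum>u\<in>verts (ZT n h). \<Sum>\<alpha>\<in>Aut (ZT n h). int (graph_dist (ZT n h) u (\<alpha> u)))"
  define F where "F = (\<Sum>i\<le>n. cyc_sum h (int n + 1 - 2 * int i))"
  \<comment> \<open>The factor 3 produces the multiples of the three sums whose closed forms are
    free of division.\<close>
  have "3 * S = 2 * int h * (3 * (int n + 1) * (2 * cyc_sum h 0)
      + 3 * int h * (2 * (\<Sum>i\<le>n. \<bar>int n - 2 * int i\<bar>)) + 6 * F)"
    unfolding S_def F_def sum_dist_ZT[OF n h] by (simp add: algebra_simps)
  also have "\<dots> = 2 * int h * (3 * (int n + 1) * ((int h)\<^sup>2 - (if even h then 0 else 1))
      + 3 * int h * ((int n + 1)\<^sup>2 - (if even n then 1 else 0)) + 6 * F)"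
    using h by (simp only: cyc_sum_0 sum_abs_layers)
  finally have "real_of_int (3 * S) = real_of_int \<dots>"
    by (rule arg_cong)
  then have S: "3 * real_of_int S = 2 * real h * (3 * (real n + 1) * ((real h)\<^sup>2 - (if even h then 0 else 1))
      + 3 * real h * ((real n + 1)\<^sup>2 - (if even n then 1 else 0)) + 6 * real_of_int F)"
    by simp
  have "card (verts (ZT n h)) = 2 * (n + 1) * h"
    by (simp add: ZT_def card_cartesian_product)
  then have "GP_index (ZT n h) = real (2 * (n + 1) * h) / (2 * real (4 * h)) * real_of_int S"
    by (simp add: GP_index_def card_Aut_ZT[OF n h] S_def)
  also have "\<dots> = (real n + 1) / 12 * (3 * real_of_int S)"
    using h by (simp add: field_simps)
  finally show ?thesis
    unfolding S F_def[symmetric] by (simp add: field_simps)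
qed

section \<open>Closed forms for short and long tubes\<close>

lemma GP_index_ZT_short:
  assumes "n \<ge> 1" "h \<ge> 3" "n + 1 \<le> h"
  shows "GP_index (ZT n h) = real h * (real n + 1) / 6 *
    (3 * (real n + 1) * ((real h)\<^sup>2 - (if even h then 0 else 1))
     + 3 * real h * ((real n + 1)\<^sup>2 - (if even n then 1 else 0))
     + (real n + 1) * (3 * (real h)\<^sup>2 + (real n + 1)\<^sup>2 + 2 - (if even (h + n) then 3 else 0)))"
proof -
  have "6 * (\<Sum>i\<le>n. cyc_sum h (int n + 1 - 2 * int i)) =
      (int n + 1) * (3 * (int h)\<^sup>2 + (int n + 1)\<^sup>2 + 2 - (if even (h + n) then 3 else 0))"
    using assms by (intro sum_cyc_sum_short) auto
  then show ?thesis
    unfolding GP_index_ZT[OF assms(1,2)] by simp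
qed

lemma GP_index_ZT_long:
  assumes "n \<ge> 1" "h \<ge> 3" "h \<le> n + 2"
  shows "GP_index (ZT n h) = real h * (real n + 1) / 6 *
    (3 * (real n + 1) * ((real h)\<^sup>2 - (if even h then 0 else 1))
     + 3 * real h * ((real n + 1)\<^sup>2 - (if even n then 1 else 0))
     + 3 * real h * (real n + 1)\<^sup>2 + real h ^ 3 + 2 * real h - (if even (h + n) then 3 * real h else 0))"
proof -
  have "6 * (\<Sum>i\<le>n. cyc_sum h (int n + 1 - 2 * int i)) =
      3 * int h * (int n + 1)\<^sup>2 + (int h) ^ 3 + 2 * int h - (if even (h + n) then 3 * int h else 0)"
    using assms by (intro sum_cyc_sum_long) auto
  then show ?thesis
    unfolding GP_index_ZT[OF assms(1,2)] by simp
qed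

theorem mainTheorem3:
  fixes n h :: nat
  assumes "n \<ge> 1" and "h \<ge> 2"
  shows "
    (odd h \<and> odd n \<longrightarrow>
      (n < h - 2 \<longrightarrow> GP_index (ZT n h) =
        real h / 6 * (real n + 1)^2 * (6 * real h^2 + 3 * real h * real n + 3 * real h + real n^2 + 2 * real n - 3)) \<and>
      (n = h - 2 \<and> n \<ge> 3 \<longrightarrow> GP_index (ZT n h) =
        real h / 6 * (real n + 1) * (6 * real h^2 * real n + 3 * real h^2 + 3 * real h * real n^2 + 12 * real h * real n + 9 * real h + real n^3 - 7 * real n - 3)) \<and>
      (n \<ge> h \<and> h \<ge> 5 \<longrightarrow> GP_index (ZT n h) =
        real h / 6 * (real n + 1) * (real h^3 + 3 * real h^2 * real n + 3 * real h^2 + 6 * real h * real n^2 + 12 * real h * real n + 5 * real h - 3 * real n - 3))) \<and>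
    (even h \<and> odd n \<longrightarrow>
      (n < h - 2 \<longrightarrow> GP_index (ZT n h) =
        real h / 6 * (real n + 1)^2 * (6 * real h^2 + 3 * real h * real n + 3 * real h + real n^2 + 2 * real n + 3)) \<and>
      (n = h - 1 \<and> n \<ge> 3 \<longrightarrow> GP_index (ZT n h) =
        real h / 6 * (real n + 1) * (6 * real h^2 * real n + 3 * real h^2 + 3 * real h * real n^2 + 12 * real h * real n + 9 * real h + real n^3 - real n)) \<and>
      (n \<ge> h \<and> h \<ge> 4 \<longrightarrow> GP_index (ZT n h) =
        real h^2 / 6 * (real n + 1) * (real h^2 + 3 * real h * real n + 3 * real h + 6 * real n^2 + 12 * real n + 8))) \<and>
    (odd h \<and> even n \<longrightarrow>
      (n < h - 2 \<longrightarrow> GP_index (ZT n h) =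
        real h / 6 * (real n + 1) * (6 * real h^2 * real n + 6 * real h^2 + 3 * real h * real n^2 + 6 * real h * real n + real n^3 + 3 * real n^2 + 2 * real n)) \<and>
      (n = h - 1 \<and> n \<ge> 4 \<longrightarrow> GP_index (ZT n h) =
        real h / 6 * (real n + 1) * (6 * real h^2 * real n + 3 * real h^2 + 3 * real h * real n^2 + 12 * real h * real n + 6 * real h + real n^3 - 4 * real n - 3)) \<and>
      (n \<ge> h \<and> h \<ge> 5 \<longrightarrow> GP_index (ZT n h) =
        real h / 6 * (real n + 1) * (real h^3 + 3 * real h^2 * real n + 3 * real h^2 + 6 * real h * real n^2 + 12 * real h * real n + 5 * real h - 3 * real n - 3))) \<and>
    (even h \<and> even n \<longrightarrow>
      (n < h - 2 \<longrightarrow> GP_index (ZT n h) =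
        real h / 6 * (real n + 1) * (6 * real h^2 * real n + 6 * real h^2 + 3 * real h * real n^2 + 6 * real h * real n + real n^3 + 3 * real n^2 + 2 * real n)) \<and>
      (n = h - 2 \<and> n \<ge> 4 \<longrightarrow> GP_index (ZT n h) =
        real h / 6 * (real n + 1) * (6 * real h^2 * real n + 3 * real h^2 + 3 * real h * real n^2 + 12 * real h * real n + 6 * real h + real n^3 - 4 * real n)) \<and>
      (n \<ge> h \<and> h \<ge> 6 \<longrightarrow> GP_index (ZT n h) =
        real h^2 / 6 * (real n + 1) * (real h^2 + 3 * real h * real n + 3 * real h + 6 * real n^2 + 12 * real n + 2)))"
proof -
  \<comment> \<open>Every case of the statement forces \<open>h \<ge> 3\<close>. This form covers
    \<open>n = h - 2\<close> and \<open>n = h - 1\<close> as well as \<open>n \<ge> h\<close>, so it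
    and \<open>short\<close> suffice.\<close>
  have long: "GP_index (ZT n h) = real h * (real n + 1) / 6 *
    (3 * (real n + 1) * ((real h)\<^sup>2 - (if even h then 0 else 1))
     + 3 * real h * ((real n + 1)\<^sup>2 - (if even n then 1 else 0))
     + 3 * real h * (real n + 1)\<^sup>2 + real h ^ 3 + 2 * real h - (if even h = even n then 3 * real h else 0))"
    if "h \<ge> 3" "h \<le> n + 2"
    using GP_index_ZT_long[OF assms(1) that] by simp
  have short: "GP_index (ZT n h) = real h * (real n + 1) / 6 *
    (3 * (real n + 1) * ((real h)\<^sup>2 - (if even h then 0 else 1))
     + 3 * real h * ((real n + 1)\<^sup>2 - (if even n then 1 else 0))
     + (real n + 1) * (3 * (real h)\<^sup>2 + (real n + 1)\<^sup>2 + 2 - (if even h = even n then 3 else 0)))"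
    if "n < h - 2"
    using GP_index_ZT_short[OF assms(1), of h] that by simp
  note [simp] = power2_eq_square power3_eq_cube
  show ?thesis
  proof (intro conjI impI; elim conjE)
    assume "odd h" "odd n" "n < h - 2"
    then show "GP_index (ZT n h) = real h / 6 * (real n + 1)^2 * (6 * real h^2 + 3 * real h * real n + 3 * real h + real n^2 + 2 * real n - 3)"
      by (simp add: short field_simps)
  next
    \<comment> \<open>The stated polynomial and the one from \<open>long\<close> are not identical
      in \<open>h\<close> and \<open>n\<close>; they agree after substituting
      \<open>h = n + 2\<close>. The other cases with \<open>n = h - 1\<close> or
      \<open>n = h - 2\<close> are treated in the same way.\<close>
    assume n: "odd n" "n = h - 2" "n \<ge> 3"
    then have "real h = real n + 2" "h \<ge> 3" "h \<le> n + 2" "even h = even (n + 2)" by auto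
    then show "GP_index (ZT n h) = real h / 6 * (real n + 1) * (6 * real h^2 * real n + 3 * real h^2 + 3 * real h * real n^2 + 12 * real h * real n + 9 * real h + real n^3 - 7 * real n - 3)"
      using n(1) by (simp add: long field_simps)
  next
    assume "odd h" "odd n" "n \<ge> h" "h \<ge> 5"
    then show "GP_index (ZT n h) = real h / 6 * (real n + 1) * (real h^3 + 3 * real h^2 * real n + 3 * real h^2 + 6 * real h * real n^2 + 12 * real h * real n + 5 * real h - 3 * real n - 3)"
      by (simp add: long field_simps)
  next
    assume "even h" "odd n" "n < h - 2"
    then show "GP_index (ZT n h) = real h / 6 * (real n + 1)^2 * (6 * real h^2 + 3 * real h * real n + 3 * real h + real n^2 + 2 * real n + 3)"
      by (simp add: short field_simps)
  next
    assume n: "odd n" "n = h - 1" "n \<ge> 3"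
    then have "real h = real n + 1" "h \<ge> 3" "h \<le> n + 2" "even h = even (n + 1)" by auto
    then show "GP_index (ZT n h) = real h / 6 * (real n + 1) * (6 * real h^2 * real n + 3 * real h^2 + 3 * real h * real n^2 + 12 * real h * real n + 9 * real h + real n^3 - real n)"
      using n(1) by (simp add: long field_simps)
  next
    assume "even h" "odd n" "n \<ge> h" "h \<ge> 4"
    then show "GP_index (ZT n h) = real h^2 / 6 * (real n + 1) * (real h^2 + 3 * real h * real n + 3 * real h + 6 * real n^2 + 12 * real n + 8)"
      by (simp add: long field_simps)
  next
    assume "odd h" "even n" "n < h - 2"
    then show "GP_index (ZT n h) = real h / 6 * (real n + 1) * (6 * real h^2 * real n + 6 * real h^2 + 3 * real h * real n^2 + 6 * real h * real n + real n^3 + 3 * real n^2 + 2 * real n)"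
      by (simp add: short field_simps)
  next
    assume n: "even n" "n = h - 1" "n \<ge> 4"
    then have "real h = real n + 1" "h \<ge> 3" "h \<le> n + 2" "even h = even (n + 1)" by auto
    then show "GP_index (ZT n h) = real h / 6 * (real n + 1) * (6 * real h^2 * real n + 3 * real h^2 + 3 * real h * real n^2 + 12 * real h * real n + 6 * real h + real n^3 - 4 * real n - 3)"
      using n(1) by (simp add: long field_simps)
  next
    assume "odd h" "even n" "n \<ge> h" "h \<ge> 5"
    then show "GP_index (ZT n h) = real h / 6 * (real n + 1) * (real h^3 + 3 * real h^2 * real n + 3 * real h^2 + 6 * real h * real n^2 + 12 * real h * real n + 5 * real h - 3 * real n - 3)"
      by (simp add: long field_simps)
  next
    assume "even h" "even n" "n < h - 2"
    then show "GP_index (ZT n h) = real h / 6 * (real n + 1) * (6 * real h^2 * real n + 6 * real h^2 + 3 * real h * real n^2 + 6 * real h * real n + real n^3 + 3 * real n^2 + 2 * real n)"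
      by (simp add: short field_simps)
  next
    assume n: "even n" "n = h - 2" "n \<ge> 4"
    then have "real h = real n + 2" "h \<ge> 3" "h \<le> n + 2" "even h = even (n + 2)" by auto
    then show "GP_index (ZT n h) = real h / 6 * (real n + 1) * (6 * real h^2 * real n + 3 * real h^2 + 3 * real h * real n^2 + 12 * real h * real n + 6 * real h + real n^3 - 4 * real n)"
      using n(1) by (simp add: long field_simps)
  next
    assume "even h" "even n" "n \<ge> h" "h \<ge> 6"
    then show "GP_index (ZT n h) = real h^2 / 6 * (real n + 1) * (real h^2 + 3 * real h * real n + 3 * real h + 6 * real n^2 + 12 * real n + 2)"
      by (simp add: long field_simps)
  qed
qed

end
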